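(* In the category $\mathbf{CGWH}$ of compactly generated weakly Hausdorff spaces, for each $X$ let $K(X)$ be the collection of families $\{A_\alpha\to X\}_{\alpha\in\mathcal{A}}$ such that the induced map $\coprod_{\alpha\in\mathcal{A}}A_\alpha\to X$ is a quotient map. Then $K$ is a Grothendieck basis generating the canonical topology on $\mathbf{CGWH}$. In particular, a sieve $S=\langle\{A_\alpha\to X\}_{\alpha\in\mathcal{A}}\rangle$ on $X$ is in the canonical topology if and only if $\coprod_{\alpha\in\mathcal{A}}A_\alpha\to X$ is a quotient map. Moreover, every colim sieve in $\mathbf{CGWH}$ is a universal colim sieve.
   Context: A subset $Y$ of a space $X$ is $k$-closed if $u^{-1}(Y)$ is closed in $K$ for every continuous $u\colon K\to X$ with $K$ compact Hausdorff; $X$ is compactly generated if every $k$-closed subset is closed. A compactly generated space $X$ is weakly Hausdorff if and only if its diagonal is closed in the product $X\times X$ taken in compactly generated spaces. $\mathbf{CGWH}$ is the category of such spaces and continuous maps. A sieve $S$ on an object $X$ of a category is a collection of morphisms with codomain $X$ closed under precomposition; it is regarded as a full subcategory of the overcategory of $X$, with forgetful functor $U$ sending a morphism to its domain. For $f\colon Y\to X$, $f^\ast S=\{h \text{ with codomain } Y : f\circ h\in S\}$. $\langle\{A_\alpha\to X\}\rangle$ denotes the sieve generated by the family, i.e. all morphisms to $X$ factoring through a member of the family. $S$ is a colim sieve if $\operatorname{colim}_S U$ exists and the canonical map $\operatorname{colim}_S U\to X$ is an isomorphism; it is a universal colim sieve if $\alpha^\ast S$ is a colim sieve on $Y$ for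 every morphism $\alpha\colon Y\to X$. The canonical topology is the largest Grothendieck topology for which all representable presheaves are sheaves (equivalently, the collection of all universal colim sieves). A Grothendieck basis is a basis for a Grothendieck topology (pretopology) in the sense of Mac Lane–Moerdijk; it generates the topology whose covering sieves are those containing a family in the basis. Families are indexed by sets. *)

theory Defs
  imports "HOL-Analysis.Analysis"
begin

section \<open>Categories, sieves and Grothendieck topologies\<close>

record ('o, 'a) cat =
  Obj :: "'o set"
  Arr :: "'a set"
  Dom :: "'a \<Rightarrow> 'o"
  Cod :: "'a \<Rightarrow> 'o"
  Ident :: "'o \<Rightarrow> 'a"
  Comp :: "'a \<Rightarrow> 'a \<Rightarrow> 'a"  \<comment> \<open>\<open>Comp C g f\<close> is \<open>f\<close> followed by \<open>g\<close>\<close>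

definition hom :: "('o, 'a) cat \<Rightarrow> 'o \<Rightarrow> 'o \<Rightarrow> 'a set" where
  "hom C X Y = {f \<in> Arr C. Dom C f = X \<and> Cod C f = Y}"

definition arrows_to :: "('o, 'a) cat \<Rightarrow> 'o \<Rightarrow> 'a set" where
  "arrows_to C X = {f \<in> Arr C. Cod C f = X}"

definition category :: "('o, 'a) cat \<Rightarrow> bool" where
  "category C \<longleftrightarrow>
     (\<forall>f\<in>Arr C. Dom C f \<in> Obj C \<and> Cod C f \<in> Obj C) \<and>
     (\<forall>X\<in>Obj C. Ident C X \<in> hom C X X) \<and>
     (\<forall>f\<in>Arr C. \<forall>g\<in>Arr C. Dom C g = Cod C f \<longrightarrow> Comp C g f \<in> hom C (Dom C f) (Cod C g)) \<and>
     (\<forall>f\<in>Arr C. Comp C f (Ident C (Dom C f)) = f \<and> Comp C (Ident C (Cod C f)) f = f) \<and>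
     (\<forall>f\<in>Arr C. \<forall>g\<in>Arr C. \<forall>h\<in>Arr C. Dom C g = Cod C f \<and> Dom C h = Cod C g \<longrightarrow>
        Comp C h (Comp C g f) = Comp C (Comp C h g) f)"

definition iso :: "('o, 'a) cat \<Rightarrow> 'a \<Rightarrow> bool" where
  "iso C f \<longleftrightarrow> f \<in> Arr C \<and>
     (\<exists>g\<in>hom C (Cod C f) (Dom C f).
        Comp C g f = Ident C (Dom C f) \<and> Comp C f g = Ident C (Cod C f))"

definition sieve :: "('o, 'a) cat \<Rightarrow> 'o \<Rightarrow> 'a set \<Rightarrow> bool" where
  "sieve C X S \<longleftrightarrow> S \<subseteq> arrows_to C X \<and>
     (\<forall>f\<in>S. \<forall>g\<in>arrows_to C (Dom C f). Comp C f g \<in> S)"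

definition sieve_pullback :: "('o, 'a) cat \<Rightarrow> 'a \<Rightarrow> 'a set \<Rightarrow> 'a set" where
  "sieve_pullback C f S = {h \<in> arrows_to C (Dom C f). Comp C f h \<in> S}"

definition generated_sieve :: "('o, 'a) cat \<Rightarrow> 'o \<Rightarrow> 'i set \<Rightarrow> ('i \<Rightarrow> 'a) \<Rightarrow> 'a set" where
  "generated_sieve C X I f =
     {h \<in> arrows_to C X. \<exists>i\<in>I. \<exists>g\<in>hom C (Dom C h) (Dom C (f i)). h = Comp C (f i) g}"

text \<open>A sieve \<open>S\<close> on \<open>X\<close> is the full subcategory of the overcategory of \<open>X\<close> on \<open>S\<close>: a morphism
  from \<open>f'\<close> to \<open>f\<close> is an arrow \<open>g\<close> with \<open>f \<circ> g = f'\<close>.  The next two definitions are cocones and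
  colimits of the forgetful functor, which sends \<open>f\<close> to its domain and \<open>g\<close> to \<open>g\<close>.\<close>

definition sieve_cocone :: "('o, 'a) cat \<Rightarrow> 'a set \<Rightarrow> 'o \<Rightarrow> ('a \<Rightarrow> 'a) \<Rightarrow> bool" where
  "sieve_cocone C S L c \<longleftrightarrow> L \<in> Obj C \<and>
     (\<forall>f\<in>S. c f \<in> hom C (Dom C f) L) \<and>
     (\<forall>f\<in>S. \<forall>f'\<in>S. \<forall>g\<in>hom C (Dom C f') (Dom C f). Comp C f g = f' \<longrightarrow> Comp C (c f) g = c f')"

definition sieve_colimit :: "('o, 'a) cat \<Rightarrow> 'a set \<Rightarrow> 'o \<Rightarrow> ('a \<Rightarrow> 'a) \<Rightarrow> bool" where
  "sieve_colimit C S L c \<longleftrightarrow> sieve_cocone C S L c \<and>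
     (\<forall>Z z. sieve_cocone C S Z z \<longrightarrow> (\<exists>!h. h \<in> hom C L Z \<and> (\<forall>f\<in>S. Comp C h (c f) = z f)))"

definition colim_sieve :: "('o, 'a) cat \<Rightarrow> 'o \<Rightarrow> 'a set \<Rightarrow> bool" where
  "colim_sieve C X S \<longleftrightarrow> sieve C X S \<and>
     (\<exists>L c. sieve_colimit C S L c \<and>
        (\<exists>k\<in>hom C L X. (\<forall>f\<in>S. Comp C k (c f) = f) \<and> iso C k))"

definition universal_colim_sieve :: "('o, 'a) cat \<Rightarrow> 'o \<Rightarrow> 'a set \<Rightarrow> bool" where
  "universal_colim_sieve C X S \<longleftrightarrow> sieve C X S \<and>
     (\<forall>a\<in>arrows_to C X. colim_sieve C (Dom C a) (sieve_pullback C a S))"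

definition grothendieck_topology :: "('o, 'a) cat \<Rightarrow> ('o \<Rightarrow> 'a set set) \<Rightarrow> bool" where
  "grothendieck_topology C J \<longleftrightarrow>
     (\<forall>X\<in>Obj C. \<forall>S\<in>J X. sieve C X S) \<and>
     (\<forall>X\<in>Obj C. arrows_to C X \<in> J X) \<and>
     (\<forall>X\<in>Obj C. \<forall>S\<in>J X. \<forall>h\<in>arrows_to C X. sieve_pullback C h S \<in> J (Dom C h)) \<and>
     (\<forall>X\<in>Obj C. \<forall>S\<in>J X. \<forall>R. sieve C X R \<and>
        (\<forall>h\<in>S. sieve_pullback C h R \<in> J (Dom C h)) \<longrightarrow> R \<in> J X)"

text \<open>A presheaf is given by its values \<open>P\<close> and its restriction maps \<open>r\<close>, where \<open>r g\<close> maps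
  \<open>P (Cod C g)\<close> to \<open>P (Dom C g)\<close>.\<close>

definition matching_family ::
    "('o, 'a) cat \<Rightarrow> ('o \<Rightarrow> 'p set) \<Rightarrow> ('a \<Rightarrow> 'p \<Rightarrow> 'p) \<Rightarrow> 'a set \<Rightarrow> ('a \<Rightarrow> 'p) \<Rightarrow> bool" where
  "matching_family C P r S m \<longleftrightarrow>
     (\<forall>f\<in>S. m f \<in> P (Dom C f)) \<and>
     (\<forall>f\<in>S. \<forall>g\<in>arrows_to C (Dom C f). r g (m f) = m (Comp C f g))"

definition sheaf ::
    "('o, 'a) cat \<Rightarrow> ('o \<Rightarrow> 'a set set) \<Rightarrow> ('o \<Rightarrow> 'p set) \<Rightarrow> ('a \<Rightarrow> 'p \<Rightarrow> 'p) \<Rightarrow> bool" where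
  "sheaf C J P r \<longleftrightarrow>
     (\<forall>X\<in>Obj C. \<forall>S\<in>J X. \<forall>m. matching_family C P r S m \<longrightarrow>
        (\<exists>!x. x \<in> P X \<and> (\<forall>f\<in>S. r f x = m f)))"

definition subcanonical :: "('o, 'a) cat \<Rightarrow> ('o \<Rightarrow> 'a set set) \<Rightarrow> bool" where
  "subcanonical C J \<longleftrightarrow>
     (\<forall>Z\<in>Obj C. sheaf C J (\<lambda>X. hom C X Z) (\<lambda>g h. Comp C h g))"

definition is_canonical_topology :: "('o, 'a) cat \<Rightarrow> ('o \<Rightarrow> 'a set set) \<Rightarrow> bool" where
  "is_canonical_topology C J \<longleftrightarrow>
     grothendieck_topology C J \<and> subcanonical C J \<and>
     (\<forall>J'. grothendieck_topology C J' \<and> subcanonical C J' \<longrightarrow> (\<forall>X\<in>Obj C. J' X \<subseteq> J X))"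

definition is_pullback :: "('o, 'a) cat \<Rightarrow> 'a \<Rightarrow> 'a \<Rightarrow> 'a \<Rightarrow> 'a \<Rightarrow> bool" where
  "is_pullback C f g p q \<longleftrightarrow>
     p \<in> hom C (Dom C q) (Dom C f) \<and> q \<in> hom C (Dom C p) (Dom C g) \<and>
     Comp C f p = Comp C g q \<and>
     (\<forall>W. \<forall>a\<in>hom C W (Dom C f). \<forall>b\<in>hom C W (Dom C g). Comp C f a = Comp C g b \<longrightarrow>
        (\<exists>!u. u \<in> hom C W (Dom C p) \<and> Comp C p u = a \<and> Comp C q u = b))"

definition has_pullbacks :: "('o, 'a) cat \<Rightarrow> bool" where
  "has_pullbacks C \<longleftrightarrow>
     (\<forall>f\<in>Arr C. \<forall>g\<in>Arr C. Cod C f = Cod C g \<longrightarrow> (\<exists>p q. is_pullback C f g p q))"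

text \<open>A basis in the sense of Mac Lane and Moerdijk.  A family \<open>(f i)\<close>, \<open>i \<in> I\<close>, is the pair
  \<open>(I, f)\<close>.  The family of all composites in the last clause is naturally indexed by
  \<open>Sigma I J\<close>; as index sets live in a fixed type \<open>'i\<close>, it is reindexed along a bijection \<open>e\<close>.\<close>

definition grothendieck_basis ::
    "('o, 'a) cat \<Rightarrow> ('o \<Rightarrow> ('i set \<times> ('i \<Rightarrow> 'a)) set) \<Rightarrow> bool" where
  "grothendieck_basis C K \<longleftrightarrow> has_pullbacks C \<and>
     (\<forall>X\<in>Obj C. \<forall>(I, f)\<in>K X. \<forall>i\<in>I. f i \<in> arrows_to C X) \<and>
     (\<forall>X\<in>Obj C. \<forall>i f. f i \<in> arrows_to C X \<and> iso C (f i) \<longrightarrow> ({i}, f) \<in> K X) \<and>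
     (\<forall>X\<in>Obj C. \<forall>(I, f)\<in>K X. \<forall>g\<in>arrows_to C X. \<forall>p q.
        (\<forall>i\<in>I. is_pullback C (f i) g (p i) (q i)) \<longrightarrow> (I, q) \<in> K (Dom C g)) \<and>
     (\<forall>X\<in>Obj C. \<forall>(I, f)\<in>K X. \<forall>J g. (\<forall>i\<in>I. (J i, g i) \<in> K (Dom C (f i))) \<longrightarrow>
        (\<forall>L e. bij_betw e L (Sigma I J) \<longrightarrow>
           (L, \<lambda>l. Comp C (f (fst (e l))) (g (fst (e l)) (snd (e l)))) \<in> K X))"

definition generated_topology ::
    "('o, 'a) cat \<Rightarrow> ('o \<Rightarrow> ('i set \<times> ('i \<Rightarrow> 'a)) set) \<Rightarrow> 'o \<Rightarrow> 'a set set" where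
  "generated_topology C K X = {S. sieve C X S \<and> (\<exists>(I, f)\<in>K X. f ` I \<subseteq> S)}"


section \<open>Sizes\<close>

text \<open>The points of all spaces, and the indices of all families, are taken from one type \<open>'u\<close>.
  The predicate \<open>small\<close> says which subsets of \<open>'u\<close> may carry a space, and \<open>indexing\<close> which may
  index a family.  If \<open>'u\<close> is a Grothendieck universe then both are ``is a set of the universe'',
  and one obtains the usual category of all spaces with families indexed by sets (first lemma
  below).  Keeping the two predicates apart gives further instances whose existence is provable in
  HOL (second lemma).\<close>

definition size_regime :: "('u set \<Rightarrow> bool) \<Rightarrow> ('u set \<Rightarrow> bool) \<Rightarrow> bool" where
  "size_regime small indexing \<longleftrightarrow> infinite (UNIV :: 'u set) \<and>
     (\<forall>a. small {a}) \<and> (\<forall>a. indexing {a}) \<and>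
     (\<forall>A B C. small A \<and> small B \<and> C \<lesssim> A \<times> B \<longrightarrow> small C) \<and>
     (\<forall>A. small A \<longrightarrow> (\<exists>I. indexing I \<and> Pow A \<lesssim> I)) \<and>
     (\<forall>I J L. indexing I \<and> (\<forall>i\<in>I. indexing (J i)) \<and> L \<lesssim> Sigma I J \<longrightarrow> indexing L)"

lemma size_regime_inaccessible:
  assumes inf: "infinite (UNIV :: 'u set)"
    and limit: "\<And>A :: 'u set. A \<prec> (UNIV :: 'u set) \<Longrightarrow> Pow A \<prec> (UNIV :: 'u set)"
    and regular: "\<And>(I :: 'u set) (J :: 'u \<Rightarrow> 'u set). I \<prec> (UNIV :: 'u set) \<Longrightarrow>
      (\<And>i. i \<in> I \<Longrightarrow> J i \<prec> (UNIV :: 'u set)) \<Longrightarrow> Sigma I J \<prec> (UNIV :: 'u set)"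
  shows "size_regime (\<lambda>A :: 'u set. A \<prec> (UNIV :: 'u set)) (\<lambda>A. A \<prec> (UNIV :: 'u set))"
proof -
  have 1: "{a} \<prec> (UNIV :: 'u set)" for a :: 'u
    by (simp add: finite_lesspoll_infinite inf)
  have 2: "C \<prec> (UNIV :: 'u set)"
    if "A \<prec> (UNIV :: 'u set)" "B \<prec> (UNIV :: 'u set)" "C \<lesssim> A \<times> B" for A B C :: "'u set"
    using regular[of A "\<lambda>_. B"] that lesspoll_trans1 by blast
  have 3: "\<exists>I :: 'u set. I \<prec> (UNIV :: 'u set) \<and> Pow A \<lesssim> I"
    if A: "A \<prec> (UNIV :: 'u set)" for A :: "'u set"
  proof -
    obtain f :: "'u set \<Rightarrow> 'u" where f: "inj_on f (Pow A)"
      using limit[OF A] by (auto simp: lesspoll_def lepoll_def)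
    then have "Pow A \<approx> f ` Pow A"
      by (meson bij_betw_imageI eqpoll_def)
    then show ?thesis
      using limit[OF A] by (meson eqpoll_imp_lepoll eqpoll_sym lesspoll_trans1)
  qed
  have 4: "L \<prec> (UNIV :: 'u set)"
    if "I \<prec> (UNIV :: 'u set)" "\<forall>i\<in>I. J i \<prec> (UNIV :: 'u set)" "L \<lesssim> Sigma I J"
    for I L :: "'u set" and J :: "'u \<Rightarrow> 'u set"
    using regular[of I J] that lesspoll_trans1 by blast
  show ?thesis
    unfolding size_regime_def using inf 1 2 3 4 by blast
qed

lemma size_regime_Pow:
  assumes inf: "infinite (UNIV :: 'b set)"
  shows "size_regime (\<lambda>A :: 'b set set. A \<lesssim> (UNIV :: 'b set)) (\<lambda>_. True)"
proof -
  have sing: "{a} \<lesssim> (UNIV :: 'b set)" for a :: "'b set"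
    by (simp add: finite_lepoll_infinite inf)
  have times: "C \<lesssim> (UNIV :: 'b set)"
    if "A \<lesssim> (UNIV :: 'b set)" "B \<lesssim> (UNIV :: 'b set)" "C \<lesssim> A \<times> B" for A B C :: "'b set set"
  proof -
    have "(UNIV :: 'b set) \<times> (UNIV :: 'b set) \<approx> (UNIV :: 'b set)"
      using card_of_Times_same_infinite[OF inf] by (simp add: eqpoll_iff_card_of_ordIso)
    then show ?thesis
      using lepoll_trans[OF that(3) lepoll_trans[OF times_lepoll_mono[OF that(1,2)]]]
      by (auto dest: eqpoll_imp_lepoll)
  qed
  have Pow: "Pow A \<lesssim> (UNIV :: 'b set set)"
    if A: "A \<lesssim> (UNIV :: 'b set)" for A :: "'b set set"
  proof -
    obtain f :: "'b set \<Rightarrow> 'b" where f: "inj_on f A"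
      using A by (auto simp: lepoll_def)
    then show ?thesis
      unfolding lepoll_def using inj_on_image_Pow by blast
  qed
  have "infinite (UNIV :: 'b set set)"
    using inf by (simp add: Finite_Set.finite_set)
  then show ?thesis
    unfolding size_regime_def using sing times Pow by blast
qed


section \<open>The category \<open>CGWH\<close>\<close>

definition k_closed :: "('u set \<Rightarrow> bool) \<Rightarrow> 'b topology \<Rightarrow> 'b set \<Rightarrow> bool" where
  "k_closed small X Y \<longleftrightarrow> Y \<subseteq> topspace X \<and>
     (\<forall>(K :: 'u topology) u.
        small (topspace K) \<and> compact_space K \<and> Hausdorff_space K \<and> continuous_map K X u \<longrightarrow>
        closedin K {x \<in> topspace K. u x \<in> Y})"

definition compactly_generated :: "('u set \<Rightarrow> bool) \<Rightarrow> 'b topology \<Rightarrow> bool" where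
  "compactly_generated small X \<longleftrightarrow> (\<forall>Y. k_closed small X Y \<longrightarrow> closedin X Y)"

definition k_ification :: "('u set \<Rightarrow> bool) \<Rightarrow> 'b topology \<Rightarrow> 'b topology" where
  "k_ification small X =
     topology (\<lambda>U. U \<subseteq> topspace X \<and> k_closed small X (topspace X - U))"

lemma istopology_k_ification:
  fixes small :: "'u set \<Rightarrow> bool" and X :: "'b topology"
  shows "istopology (\<lambda>U. U \<subseteq> topspace X \<and> k_closed small X (topspace X - U))"
proof -
  have eq: "k_closed small X (topspace X - U) \<longleftrightarrow>
      (\<forall>(K :: 'u topology) u.
        small (topspace K) \<and> compact_space K \<and> Hausdorff_space K \<and> continuous_map K X u \<longrightarrow>
        openin K {x \<in> topspace K. u x \<in> U})" if "U \<subseteq> topspace X" for U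
  proof -
    have *: "closedin K {x \<in> topspace K. u x \<in> topspace X - U}
        \<longleftrightarrow> openin K {x \<in> topspace K. u x \<in> U}"
      if "continuous_map K X u" for K :: "'u topology" and u
    proof -
      have "topspace K - {x \<in> topspace K. u x \<in> topspace X - U} = {x \<in> topspace K. u x \<in> U}"
        using that by (auto simp: continuous_map_def Pi_iff)
      then show ?thesis by (auto simp: closedin_def)
    qed
    show ?thesis unfolding k_closed_def using * by blast
  qed
  have Int: "k_closed small X (topspace X - (U \<inter> V))"
    if "U \<subseteq> topspace X" "V \<subseteq> topspace X"
      "k_closed small X (topspace X - U)" "k_closed small X (topspace X - V)" for U V
  proof -
    have "{x \<in> topspace K. u x \<in> U \<inter> V}
        = {x \<in> topspace K. u x \<in> U} \<inter> {x \<in> topspace K. u x \<in> V}" for K :: "'u topology" and u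
      by auto
    then show ?thesis
      using that eq[of U] eq[of V] eq[of "U \<inter> V"] by (simp add: le_infI1 openin_Int)
  qed
  have Un: "k_closed small X (topspace X - \<Union>\<U>)"
    if "\<forall>U\<in>\<U>. U \<subseteq> topspace X \<and> k_closed small X (topspace X - U)" for \<U>
  proof -
    have *: "{x \<in> topspace K. u x \<in> \<Union>\<U>} = (\<Union>U\<in>\<U>. {x \<in> topspace K. u x \<in> U})"
      for K :: "'u topology" and u
      by auto
    have "openin K {x \<in> topspace K. u x \<in> \<Union>\<U>}"
      if "small (topspace K) \<and> compact_space K \<and> Hausdorff_space K \<and> continuous_map K X u"
      for K :: "'u topology" and u
      unfolding * using that eq \<open>\<forall>U\<in>\<U>. _ U\<close> by (intro openin_Union) blast
    then show ?thesis
      using that eq[of "\<Union>\<U>"] by blast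
  qed
  show ?thesis
    unfolding istopology_def using Int Un by (blast intro: le_infI1)
qed

definition weakly_hausdorff :: "('u set \<Rightarrow> bool) \<Rightarrow> 'b topology \<Rightarrow> bool" where
  "weakly_hausdorff small X \<longleftrightarrow>
     closedin (k_ification small (prod_topology X X)) {(x, x) | x. x \<in> topspace X}"

text \<open>The underlying function of a morphism is required to be \<open>undefined\<close> outside the source, so
  that equality of morphisms is equality of maps.\<close>

datatype 'u cmap = CMap (source: "'u topology") (fn: "'u \<Rightarrow> 'u") (target: "'u topology")

definition CGWH :: "('u set \<Rightarrow> bool) \<Rightarrow> ('u topology, 'u cmap) cat" where
  "CGWH small =
     (let Ob = {X :: 'u topology. small (topspace X) \<and>
                  compactly_generated small X \<and> weakly_hausdorff small X}
      in \<lparr> Obj = Ob,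
           Arr = {a. source a \<in> Ob \<and> target a \<in> Ob \<and>
                     continuous_map (source a) (target a) (fn a) \<and>
                     fn a \<in> extensional (topspace (source a))},
           Dom = source,
           Cod = target,
           Ident = (\<lambda>X. CMap X (\<lambda>x\<in>topspace X. x) X),
           Comp = (\<lambda>g f. CMap (source f) (compose (topspace (source f)) (fn g) (fn f)) (target g)) \<rparr>)"

lemma category_CGWH: "category (CGWH small)"
proof -
  have id: "continuous_map X X (\<lambda>x\<in>topspace X. x)" for X :: "'a topology"
    by (rule continuous_map_eq[OF continuous_map_id]) auto
  have comp: "continuous_map X Z (compose (topspace X) g f)"
    if "continuous_map X Y f" "continuous_map Y Z g" for X Y Z :: "'a topology" and f g
    by (rule continuous_map_eq[OF continuous_map_compose[OF that]]) (auto simp: compose_def)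
  have fn: "fn f \<in> topspace (source f) \<rightarrow> topspace (target f)"
    if "continuous_map (source f) (target f) (fn f)" for f :: "'a cmap"
    using that by (auto simp: continuous_map_def)
  have idr: "compose A f (\<lambda>x\<in>A. x) = f" if "f \<in> extensional A" for A :: "'a set" and f :: "'a \<Rightarrow> 'a"
    using that by (auto simp: compose_def fun_eq_iff extensional_def)
  have idl: "compose A (\<lambda>x\<in>B. x) f = f"
    if "f \<in> extensional A" "f \<in> A \<rightarrow> B" for A B :: "'a set" and f :: "'a \<Rightarrow> 'a"
    using that by (auto simp: compose_def fun_eq_iff extensional_def)
  have assoc: "compose A h (compose A g f) = compose A (compose B h g) f"
    if "f \<in> A \<rightarrow> B" for A B :: "'a set" and f g h :: "'a \<Rightarrow> 'a"
    using that by (auto simp: compose_def fun_eq_iff)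
  show ?thesis
    unfolding category_def hom_def CGWH_def Let_def
    by (auto simp: id idr idl fn compose_extensional intro: comp intro!: assoc[OF fn])
qed

text \<open>The coproduct of spaces is their disjoint union, which here is a topology on \<open>'i \<times> 'u\<close>.\<close>

definition coproduct_quotient :: "'u topology \<Rightarrow> 'i set \<Rightarrow> ('i \<Rightarrow> 'u cmap) \<Rightarrow> bool" where
  "coproduct_quotient X I f \<longleftrightarrow>
     quotient_map (sum_topology (\<lambda>i. source (f i)) I) X (\<lambda>(i, a). fn (f i) a)"

definition quotient_families ::
    "('u set \<Rightarrow> bool) \<Rightarrow> ('u set \<Rightarrow> bool) \<Rightarrow> 'u topology \<Rightarrow> ('u set \<times> ('u \<Rightarrow> 'u cmap)) set" where
  "quotient_families small indexing X =
     {(I, f). indexing I \<and> (\<forall>i\<in>I. f i \<in> arrows_to (CGWH small) X) \<and> coproduct_quotient X I f}"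

end

theory Submission
  imports Defs
begin

text \<open>
  Call a set of maps into \<open>X\<close> \<^emph>\<open>jointly quotient\<close> if it covers the points of \<open>X\<close> and detects
  the closed subsets of \<open>X\<close>.  For an indexed family this says that the map from the coproduct is a
  quotient map, but it also makes sense for sieves, which are too large to be indexed.  Everything
  follows from two facts about a sieve \<open>S\<close> on an object \<open>X\<close> of \<open>CGWH\<close>.

  First, \<open>S\<close> is a colim sieve if and only if it is jointly quotient
  (\<open>colim_sieve_iff_jointly_quotient\<close>).  Let \<open>T\<close> be the union of the images of the members of \<open>S\<close>
  with the final topology.  It is compactly generated, being a quotient of compactly generated
  spaces, and weakly Hausdorff, because it maps injectively to \<open>X\<close>.  Hence it is an object of
  \<open>CGWH\<close>.  Since \<open>S\<close> contains all composites with maps from a point, a cocone under \<open>S\<close> takes equal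
  values at points with the same image in \<open>X\<close>.  Therefore \<open>T\<close> is the colimit, and the canonical map
  to \<open>X\<close> is an isomorphism just when \<open>T = X\<close> as spaces.  A cocone with vertex \<open>Z\<close> is the same as a
  matching family for the presheaf represented by \<open>Z\<close>, so the sieves for which all representable
  presheaves satisfy the sheaf condition are again the jointly quotient ones.

  Secondly, jointly quotient sieves are stable under pullback along any map \<open>Y \<rightarrow> X\<close>
  (\<open>jointly_quotient_sieve_pullback\<close>).  As \<open>Y\<close> is compactly generated, this is a question about maps
  \<open>v: K \<rightarrow> X\<close> from a compact Hausdorff space, and there it is settled by two observations:
  the fibre product of two compact Hausdorff spaces over \<open>X\<close> is compact Hausdorff because \<open>X\<close> is
  weakly Hausdorff, and maps between compact Hausdorff spaces are closed.

  Consequently all colim sieves are universal, and the jointly quotient sieves form a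
  topology; it is the largest subcanonical one.  It is generated by the quotient families because
  a jointly quotient sieve contains such a family indexed by subsets of \<open>X\<close>: choose for each
  subset that is not closed one member of the sieve that sees this, and for each point one member
  that hits it (\<open>indexed_quotient_subfamily\<close>).
\<close>

section \<open>Testing spaces by compact Hausdorff spaces\<close>

definition test_space :: "('u set \<Rightarrow> bool) \<Rightarrow> 'u topology \<Rightarrow> bool" where
  "test_space small K \<longleftrightarrow> small (topspace K) \<and> compact_space K \<and> Hausdorff_space K"

lemma k_closed_iff:
  "k_closed small X Y \<longleftrightarrow> Y \<subseteq> topspace X \<and>
     (\<forall>K u. test_space small K \<and> continuous_map K X u \<longrightarrow> closedin K {x \<in> topspace K. u x \<in> Y})"
  by (simp add: k_closed_def test_space_def conj_assoc)

lemma k_closed_preimage: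
  assumes "k_closed small X Y" "test_space small K" "continuous_map K X u"
  shows "closedin K {x \<in> topspace K. u x \<in> Y}"
  using assms by (auto simp: k_closed_iff)

lemma closedin_imp_k_closed: "closedin X Y \<Longrightarrow> k_closed small X Y"
  by (auto simp: k_closed_iff closedin_subset intro: closedin_continuous_map_preimage)

lemma k_closed_continuous_preimage:
  assumes "k_closed small Y C" "continuous_map X Y f"
  shows "k_closed small X {x \<in> topspace X. f x \<in> C}"
proof -
  have "closedin K {k \<in> topspace K. u k \<in> {x \<in> topspace X. f x \<in> C}}"
    if K: "test_space small K" and u: "continuous_map K X u" for K u
  proof -
    have "{k \<in> topspace K. u k \<in> {x \<in> topspace X. f x \<in> C}} = {k \<in> topspace K. (f \<circ> u) k \<in> C}"
      using continuous_map_funspace[OF u] by auto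
    then show ?thesis
      using k_closed_preimage[OF assms(1) K continuous_map_compose[OF u assms(2)]] by simp
  qed
  then show ?thesis
    by (auto simp: k_closed_iff)
qed

lemma openin_k_ification:
  "openin (k_ification small X) U \<longleftrightarrow> U \<subseteq> topspace X \<and> k_closed small X (topspace X - U)"
  unfolding k_ification_def by (simp add: topology_inverse'[OF istopology_k_ification])

lemma topspace_k_ification [simp]: "topspace (k_ification small X) = topspace X"
proof (rule antisym)
  have "openin (k_ification small X) (topspace X)"
    by (simp add: openin_k_ification closedin_imp_k_closed)
  then show "topspace X \<subseteq> topspace (k_ification small X)"
    by (rule openin_subset)
  show "topspace (k_ification small X) \<subseteq> topspace X"
    using openin_topspace[of "k_ification small X"] unfolding openin_k_ification by blast
qed

lemma closedin_k_ification: "closedin (k_ification small X) C \<longleftrightarrow> k_closed small X C"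
proof -
  have "topspace X - (topspace X - C) = C" if "C \<subseteq> topspace X"
    using that by blast
  moreover have "C \<subseteq> topspace X" if "k_closed small X C"
    using that by (simp add: k_closed_iff)
  ultimately show ?thesis
    unfolding closedin_def openin_k_ification topspace_k_ification by (metis Diff_subset)
qed

lemma continuous_map_k_ification_id: "continuous_map (k_ification small X) X (\<lambda>x. x)"
proof -
  have "{x \<in> topspace X. x \<in> C} = C" if "closedin X C" for C
    using closedin_subset[OF that] by blast
  then show ?thesis
    by (auto simp: continuous_map_closedin closedin_k_ification closedin_imp_k_closed)
qed

text \<open>The universal property of the coreflection of spaces into compactly generated spaces.\<close>

lemma continuous_map_into_k_ification:
  assumes "compactly_generated small X" "continuous_map X Y f"
  shows "continuous_map X (k_ification small Y) f"
  using assms k_closed_continuous_preimage[OF _ assms(2)]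
  by (auto simp: continuous_map_closedin closedin_k_ification compactly_generated_def)

lemma test_space_compactly_generated:
  assumes "test_space small K"
  shows "compactly_generated small K"
  unfolding compactly_generated_def
proof (intro allI impI)
  fix Y assume Y: "k_closed small K Y"
  have "{x \<in> topspace K. id x \<in> Y} = Y"
    using Y by (auto simp: k_closed_iff)
  then show "closedin K Y"
    using k_closed_preimage[OF Y assms continuous_map_id] by simp
qed

lemma compactly_generated_k_ification: "compactly_generated small (k_ification small X)"
  unfolding compactly_generated_def closedin_k_ification
proof (intro allI impI)
  fix C assume C: "k_closed small (k_ification small X) C"
  show "k_closed small X C"
    unfolding k_closed_iff
    using C k_closed_preimage[OF C]
    by (auto simp: k_closed_iff continuous_map_into_k_ification test_space_compactly_generated)
qed

text \<open>A map into \<open>X \<times> X\<close> is a pair of maps, and it pulls the diagonal back to their equalizer.\<close>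

lemma weakly_hausdorff_iff_equalizers_closed:
  "weakly_hausdorff small X \<longleftrightarrow>
     (\<forall>K u v. test_space small K \<and> continuous_map K X u \<and> continuous_map K X v \<longrightarrow>
        closedin K {k \<in> topspace K. u k = v k})"
    (is "_ \<longleftrightarrow> ?E")
proof -
  let ?D = "{(x, x) | x. x \<in> topspace X}"
  have eq: "{k \<in> topspace K. w k \<in> ?D} = {k \<in> topspace K. fst (w k) = snd (w k)}"
    if "continuous_map K (prod_topology X X) w" for K :: "'a topology" and w
    using continuous_map_funspace[OF that] by (force simp: Pi_iff prod_eq_iff)
  have "k_closed small (prod_topology X X) ?D \<longleftrightarrow> ?E"
  proof
    assume D: "k_closed small (prod_topology X X) ?D"
    show ?E
    proof (intro allI impI, elim conjE)
      fix K u v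
      assume K: "test_space small K" and "continuous_map K X u" "continuous_map K X v"
      then have w: "continuous_map K (prod_topology X X) (\<lambda>k. (u k, v k))"
        by (simp add: continuous_map_paired)
      show "closedin K {k \<in> topspace K. u k = v k}"
        using k_closed_preimage[OF D K w] unfolding eq[OF w] by simp
    qed
  next
    assume E: ?E
    have "closedin K {k \<in> topspace K. w k \<in> ?D}"
      if K: "test_space small K" and w: "continuous_map K (prod_topology X X) w" for K w
    proof -
      have "continuous_map K X (\<lambda>k. fst (w k))" "continuous_map K X (\<lambda>k. snd (w k))"
        using w by (auto simp: continuous_map_pairwise o_def)
      with E K show ?thesis
        unfolding eq[OF w] by blast
    qed
    then show "k_closed small (prod_topology X X) ?D"
      by (auto simp: k_closed_iff)
  qed
  then show ?thesis
    by (simp add: weakly_hausdorff_def closedin_k_ification)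
qed

text \<open>An injective map does not change the equalizer of two test maps.\<close>

lemma weakly_hausdorff_injective:
  assumes "weakly_hausdorff small Y" "continuous_map X Y f" "inj_on f (topspace X)"
  shows "weakly_hausdorff small X"
  unfolding weakly_hausdorff_iff_equalizers_closed
proof (intro allI impI, elim conjE)
  fix K u v
  assume K: "test_space small K" and u: "continuous_map K X u" and v: "continuous_map K X v"
  have "{k \<in> topspace K. u k = v k} = {k \<in> topspace K. (f \<circ> u) k = (f \<circ> v) k}"
    using continuous_map_funspace[OF u] continuous_map_funspace[OF v] assms(3)
    by (auto simp: inj_on_def Pi_iff)
  then show "closedin K {k \<in> topspace K. u k = v k}"
    using assms(1) K continuous_map_compose[OF u assms(2)] continuous_map_compose[OF v assms(2)]
    unfolding weakly_hausdorff_iff_equalizers_closed by metis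
qed

lemma weakly_hausdorff_prod:
  assumes "weakly_hausdorff small X" "weakly_hausdorff small Y"
  shows "weakly_hausdorff small (prod_topology X Y)"
  unfolding weakly_hausdorff_iff_equalizers_closed
proof (intro allI impI, elim conjE)
  fix K u v
  assume K: "test_space small K"
    and "continuous_map K (prod_topology X Y) u" "continuous_map K (prod_topology X Y) v"
  then have *: "continuous_map K X (fst \<circ> u)" "continuous_map K X (fst \<circ> v)"
      "continuous_map K Y (snd \<circ> u)" "continuous_map K Y (snd \<circ> v)"
    by (auto simp: continuous_map_pairwise)
  have "{k \<in> topspace K. u k = v k} =
      {k \<in> topspace K. (fst \<circ> u) k = (fst \<circ> v) k} \<inter> {k \<in> topspace K. (snd \<circ> u) k = (snd \<circ> v) k}"
    by (auto simp: prod_eq_iff)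
  moreover have "closedin K {k \<in> topspace K. (fst \<circ> u) k = (fst \<circ> v) k}"
      "closedin K {k \<in> topspace K. (snd \<circ> u) k = (snd \<circ> v) k}"
    using assms K * unfolding weakly_hausdorff_iff_equalizers_closed by blast+
  ultimately show "closedin K {k \<in> topspace K. u k = v k}"
    by (simp add: closedin_Int)
qed

lemma test_space_weakly_hausdorff:
  assumes "test_space small K"
  shows "weakly_hausdorff small K"
proof -
  have "closedin (prod_topology K K) {(x, x) | x. x \<in> topspace K}"
    using assms Hausdorff_space_closedin_diagonal[of K]
    by (simp add: test_space_def image_def Setcompr_eq_image)
  then show ?thesis
    by (simp add: weakly_hausdorff_def closedin_k_ification closedin_imp_k_closed)
qed

text \<open>A fibre of a test map is the equalizer of this map and a constant one.\<close>

lemma CGWH_singleton_closed: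
  assumes "compactly_generated small X" "weakly_hausdorff small X" "x \<in> topspace X"
  shows "closedin X {x}"
proof -
  have "closedin K {k \<in> topspace K. u k \<in> {x}}"
    if "test_space small K" "continuous_map K X u" for K u
    using that assms(2,3) unfolding weakly_hausdorff_iff_equalizers_closed
    by (auto dest!: spec[of _ K] spec[of _ u] spec[of _ "\<lambda>_. x"])
  then show ?thesis
    using assms(1,3) by (auto simp: compactly_generated_def k_closed_iff)
qed

section \<open>Fibre products of compact Hausdorff spaces\<close>

text \<open>The part of a size regime that concerns spaces.\<close>

locale sizes =
  fixes small :: "'u set \<Rightarrow> bool"
  assumes infinite_points: "infinite (UNIV :: 'u set)"
    and small_singleton: "\<And>a. small {a}"
    and small_times: "\<And>A B C. small A \<Longrightarrow> small B \<Longrightarrow> C \<lesssim> A \<times> B \<Longrightarrow> small C"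
begin

lemma small_lepoll: "small A \<Longrightarrow> C \<lesssim> A \<Longrightarrow> small C"
  by (rule small_times[OF _ small_singleton[of undefined]])
    (auto intro: lepoll_trans lepoll_times1)

lemma small_subset: "small A \<Longrightarrow> C \<subseteq> A \<Longrightarrow> small C"
  by (blast intro: small_lepoll subset_imp_lepoll)

text \<open>Spaces must live on points of type \<open>'u\<close>; as this type is infinite, it contains a copy of
  its own square, along which product spaces are transported.\<close>

lemma small_copy_of_product_subspace:
  fixes T :: "('u \<times> 'u) topology"
  assumes "small A" "small B" "topspace T \<subseteq> A \<times> B"
  obtains M :: "'u topology" and j where "small (topspace M)" "homeomorphic_map M T j"
proof -
  have "(UNIV :: ('u \<times> 'u) set) \<lesssim> (UNIV :: 'u set)"
    using card_of_Times_same_infinite[OF infinite_points]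
    by (auto simp: eqpoll_iff_card_of_ordIso[symmetric] dest: eqpoll_imp_lepoll)
  then obtain i :: "'u \<times> 'u \<Rightarrow> 'u" where i: "inj i"
    by (auto simp: lepoll_def)
  define M where "M = pullback_topology (i ` topspace T) (inv i) T"
  have top: "topspace M = i ` topspace T"
    using i by (auto simp: M_def topspace_pullback_topology)
  have "topspace M \<lesssim> A \<times> B"
    using image_lepoll[of i "topspace T"] subset_imp_lepoll[OF assms(3)] lepoll_trans
    unfolding top by blast
  then have "small (topspace M)"
    using small_times assms(1,2) by blast
  moreover have "homeomorphic_map M T (inv i)"
    unfolding homeomorphic_map_maps homeomorphic_maps_def
  proof (intro exI[of _ i] conjI)
    show "continuous_map M T (inv i)"
      using continuous_map_pullback[of T T id "i ` topspace T" "inv i"] by (simp add: M_def)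
    show "continuous_map T M i"
      unfolding M_def
      by (rule continuous_map_pullback') (use i in \<open>auto simp: o_def\<close>)
  qed (use i in \<open>auto simp: top\<close>)
  ultimately show ?thesis
    by (rule that)
qed

end

text \<open>The fibre product is the equalizer of two test maps on the compact Hausdorff space
  \<open>K \<times> L\<close>, so by weak Hausdorffness it is closed there, hence compact.\<close>

lemma compact_pullback:
  fixes small :: "'u set \<Rightarrow> bool"
  assumes "sizes small" and K: "test_space small K" and L: "test_space small L"
    and X: "weakly_hausdorff small X" and v: "continuous_map K X v" and f: "continuous_map L X f"
  obtains P p q where "test_space small P" "continuous_map P K p" "continuous_map P L q"
    "\<And>z. z \<in> topspace P \<Longrightarrow> v (p z) = f (q z)"
    "\<And>k l. k \<in> topspace K \<Longrightarrow> l \<in> topspace L \<Longrightarrow> v k = f l \<Longrightarrow>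
       \<exists>z\<in>topspace P. p z = k \<and> q z = l"
proof -
  interpret sizes small by fact
  obtain M j where M: "small (topspace M)" and j: "homeomorphic_map M (prod_topology K L) j"
    using small_copy_of_product_subspace[of "topspace K" "topspace L" "prod_topology K L"] K L
    by (auto simp: test_space_def)
  have hom: "M homeomorphic_space prod_topology K L"
    using j homeomorphic_map_imp_homeomorphic_space by blast
  have tM: "test_space small M"
    using M K L homeomorphic_compact_space[OF hom] homeomorphic_Hausdorff_space[OF hom]
    by (simp add: test_space_def compact_space_prod_topology Hausdorff_space_prod_topology)
  have jc: "continuous_map M (prod_topology K L) j"
    using j homeomorphic_imp_continuous_map by blast
  then have pq: "continuous_map M K (fst \<circ> j)" "continuous_map M L (snd \<circ> j)"
    by (auto simp: continuous_map_pairwise)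
  define E where "E = {m \<in> topspace M. (v \<circ> (fst \<circ> j)) m = (f \<circ> (snd \<circ> j)) m}"
  have E: "closedin M E"
    using X tM continuous_map_compose[OF pq(1) v] continuous_map_compose[OF pq(2) f]
    unfolding weakly_hausdorff_iff_equalizers_closed E_def by blast
  have top: "topspace (subtopology M E) = E"
    using closedin_subset[OF E] by auto
  show ?thesis
  proof (rule that[of "subtopology M E" "fst \<circ> j" "snd \<circ> j"])
    show "test_space small (subtopology M E)"
      using tM E small_subset[of "topspace M" E] closedin_subset[OF E]
      unfolding test_space_def top
      by (auto simp: compact_space_subtopology closedin_compact_space Hausdorff_space_subtopology)
    show "\<exists>z\<in>topspace (subtopology M E). (fst \<circ> j) z = k \<and> (snd \<circ> j) z = l"
      if "k \<in> topspace K" "l \<in> topspace L" "v k = f l" for k l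
    proof -
      have "(k, l) \<in> j ` topspace M"
        using that homeomorphic_imp_surjective_map[OF j] by simp
      then obtain z where "z \<in> topspace M" "j z = (k, l)"
        by force
      then show ?thesis
        using that unfolding top by (auto simp: E_def intro!: bexI[of _ z])
    qed
  qed (use pq in \<open>auto simp: top E_def continuous_map_from_subtopology\<close>)
qed


section \<open>Sieves and colimits\<close>

lemma Comp_in_hom:
  assumes "category C" "f \<in> hom C X Y" "g \<in> hom C Y Z"
  shows "Comp C g f \<in> hom C X Z"
  using assms unfolding category_def hom_def by auto

lemma Comp_assoc:
  assumes "category C" "f \<in> hom C X Y" "g \<in> hom C Y Z" "h \<in> hom C Z W"
  shows "Comp C h (Comp C g f) = Comp C (Comp C h g) f"
  using assms unfolding category_def hom_def by auto

lemma Comp_Ident: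
  assumes "category C" "f \<in> hom C X Y"
  shows "Comp C f (Ident C X) = f" "Comp C (Ident C Y) f = f"
  using assms unfolding category_def hom_def by auto

lemma Ident_in_hom: "category C \<Longrightarrow> X \<in> Obj C \<Longrightarrow> Ident C X \<in> hom C X X"
  unfolding category_def by blast

lemma iso_Ident:
  assumes "category C" "X \<in> Obj C"
  shows "iso C (Ident C X)"
  using Ident_in_hom[OF assms] Comp_Ident[OF assms(1) Ident_in_hom[OF assms]]
  unfolding iso_def by (auto simp: hom_def)

lemma arrows_to_iff_hom: "f \<in> arrows_to C X \<longleftrightarrow> f \<in> hom C (Dom C f) X"
  by (auto simp: arrows_to_def hom_def)

lemma sieve_in_hom: "sieve C X S \<Longrightarrow> f \<in> S \<Longrightarrow> f \<in> hom C (Dom C f) X"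
  unfolding sieve_def arrows_to_def hom_def by blast

lemma sieve_Comp:
  assumes "sieve C X S" "f \<in> S" "g \<in> hom C W (Dom C f)"
  shows "Comp C f g \<in> S"
  using assms unfolding sieve_def arrows_to_def hom_def by blast

lemma sieve_sieve_pullback:
  assumes C: "category C" and S: "sieve C X S" and a: "a \<in> arrows_to C X"
  shows "sieve C (Dom C a) (sieve_pullback C a S)"
  unfolding sieve_def sieve_pullback_def
proof (intro conjI ballI CollectI; clarsimp?)
  fix f g
  assume f: "f \<in> arrows_to C (Dom C a)" and af: "Comp C a f \<in> S" and g: "g \<in> arrows_to C (Dom C f)"
  have h: "g \<in> hom C (Dom C g) (Dom C f)" "f \<in> hom C (Dom C f) (Dom C a)" "a \<in> hom C (Dom C a) X"
    using f g a by (auto simp: arrows_to_def hom_def)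
  have "Dom C (Comp C a f) = Dom C f"
    using Comp_in_hom[OF C h(2,3)] by (simp add: hom_def)
  then show "Comp C a (Comp C f g) \<in> S"
    using sieve_Comp[OF S af] Comp_assoc[OF C h] h(1) by metis
  show "Comp C f g \<in> arrows_to C (Dom C a)"
    using Comp_in_hom[OF C h(1,2)] by (simp add: arrows_to_def hom_def)
qed

lemma sieve_arrows_to: "category C \<Longrightarrow> sieve C X (arrows_to C X)"
  unfolding sieve_def using Comp_in_hom[of C] by (auto simp: arrows_to_def hom_def)

lemma sieve_generated_sieve:
  assumes C: "category C" and f: "\<And>i. i \<in> I \<Longrightarrow> f i \<in> arrows_to C X"
  shows "sieve C X (generated_sieve C X I f)"
  unfolding sieve_def
proof (intro conjI ballI)
  show "generated_sieve C X I f \<subseteq> arrows_to C X"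
    by (auto simp: generated_sieve_def)
next
  fix h k assume "h \<in> generated_sieve C X I f" and k: "k \<in> arrows_to C (Dom C h)"
  then obtain i g where h: "h \<in> hom C (Dom C h) X" and i: "i \<in> I"
    and g: "g \<in> hom C (Dom C h) (Dom C (f i))" and eq: "h = Comp C (f i) g"
    by (auto simp: generated_sieve_def arrows_to_iff_hom)
  have k': "k \<in> hom C (Dom C k) (Dom C h)"
    using k by (simp add: arrows_to_iff_hom)
  have fi: "f i \<in> hom C (Dom C (f i)) X"
    using f[OF i] by (simp add: arrows_to_iff_hom)
  have hk: "Comp C h k \<in> hom C (Dom C k) X"
    using Comp_in_hom[OF C k' h] .
  have "Comp C h k = Comp C (f i) (Comp C g k)"
    using Comp_assoc[OF C k' g fi] eq by simp
  then show "Comp C h k \<in> generated_sieve C X I f"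
    using hk Comp_in_hom[OF C k' g] i unfolding generated_sieve_def
    by (auto simp: hom_def arrows_to_def)
qed

text \<open>The sheaf condition at \<open>S\<close> for all representable presheaves.  It links colimits, in whose
  terms the colim sieves are defined, to subcanonical topologies.\<close>

definition effective_sieve :: "('o, 'a) cat \<Rightarrow> 'o \<Rightarrow> 'a set \<Rightarrow> bool" where
  "effective_sieve C X S \<longleftrightarrow> sieve C X S \<and>
     (\<forall>Z\<in>Obj C. \<forall>m. matching_family C (\<lambda>Y. hom C Y Z) (\<lambda>g h. Comp C h g) S m \<longrightarrow>
        (\<exists>!x. x \<in> hom C X Z \<and> (\<forall>f\<in>S. Comp C x f = m f)))"

lemma subcanonical_iff_effective:
  assumes "\<And>X S. X \<in> Obj C \<Longrightarrow> S \<in> J X \<Longrightarrow> sieve C X S"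
  shows "subcanonical C J \<longleftrightarrow> (\<forall>X\<in>Obj C. \<forall>S\<in>J X. effective_sieve C X S)"
proof -
  have "effective_sieve C X S \<longleftrightarrow>
     (\<forall>Z\<in>Obj C. \<forall>m. matching_family C (\<lambda>Y. hom C Y Z) (\<lambda>g h. Comp C h g) S m \<longrightarrow>
        (\<exists>!x. x \<in> hom C X Z \<and> (\<forall>f\<in>S. Comp C x f = m f)))" if "X \<in> Obj C" "S \<in> J X" for X S
    using assms[OF that] by (simp add: effective_sieve_def)
  then show ?thesis
    unfolding subcanonical_def sheaf_def by (simp cong: ball_cong) (rule iffI; intro ballI; simp)
qed

text \<open>A morphism of the sieve from \<open>f \<circ> g\<close> to \<open>f\<close> is an arrow \<open>g\<close>, so naturality of a cocone and
  compatibility of a matching family are the same equations.\<close>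

lemma sieve_cocone_iff_matching_family:
  assumes C: "category C" and S: "sieve C X S"
  shows "sieve_cocone C S Z m \<longleftrightarrow>
    Z \<in> Obj C \<and> matching_family C (\<lambda>Y. hom C Y Z) (\<lambda>g h. Comp C h g) S m"
proof -
  have "Comp C f g \<in> S \<and> g \<in> hom C (Dom C (Comp C f g)) (Dom C f)"
    if "f \<in> S" "g \<in> arrows_to C (Dom C f)" for f g
    using sieve_Comp[OF S that(1)] that Comp_in_hom[OF C _ sieve_in_hom[OF S that(1)]]
    unfolding arrows_to_iff_hom by (simp add: hom_def)
  moreover have "g \<in> arrows_to C (Dom C f)" if "g \<in> hom C W (Dom C f)" for W f g
    using that by (simp add: hom_def arrows_to_def)
  ultimately show ?thesis
    unfolding sieve_cocone_def matching_family_def by blast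
qed

text \<open>A colimit cocone can be carried along the isomorphism \<open>k\<close>, so \<open>S\<close> is a colim sieve just
  when \<open>X\<close> itself, with the members of \<open>S\<close> as legs, is a colimit.\<close>

lemma colim_sieve_iff_effective:
  assumes C: "category C" and X: "X \<in> Obj C"
  shows "colim_sieve C X S \<longleftrightarrow> effective_sieve C X S"
proof
  assume "effective_sieve C X S"
  then have S: "sieve C X S"
    and eff: "\<And>Z m. sieve_cocone C S Z m \<Longrightarrow> \<exists>!x. x \<in> hom C X Z \<and> (\<forall>f\<in>S. Comp C x f = m f)"
    unfolding effective_sieve_def using sieve_cocone_iff_matching_family[OF C, of X S] by blast+
  have id: "Ident C X \<in> hom C X X"
    using Ident_in_hom[OF C X] .
  have "sieve_colimit C S X (\<lambda>f. f)"
    unfolding sieve_colimit_def sieve_cocone_def[of C S X]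
    using X sieve_in_hom[OF S] eff by blast
  moreover have "Comp C (Ident C X) f = f" if "f \<in> S" for f
    using Comp_Ident(2)[OF C sieve_in_hom[OF S that]] .
  moreover have "iso C (Ident C X)"
    using iso_Ident[OF C X] .
  ultimately show "colim_sieve C X S"
    unfolding colim_sieve_def using S id by blast
next
  assume "colim_sieve C X S"
  then obtain L c k where S: "sieve C X S" and colim: "sieve_colimit C S L c"
    and k: "k \<in> hom C L X" and kc: "\<And>f. f \<in> S \<Longrightarrow> Comp C k (c f) = f" and "iso C k"
    unfolding colim_sieve_def by blast
  then obtain k' where k': "k' \<in> hom C X L" and k'k: "Comp C k' k = Ident C L"
    and kk': "Comp C k k' = Ident C X"
    unfolding iso_def hom_def by auto
  have c: "c f \<in> hom C (Dom C f) L" if "f \<in> S" for f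
    using colim that unfolding sieve_colimit_def sieve_cocone_def by blast
  have "\<exists>!x. x \<in> hom C X Z \<and> (\<forall>f\<in>S. Comp C x f = m f)"
    if m: "sieve_cocone C S Z m" for Z m
  proof -
    obtain h where h: "h \<in> hom C L Z" "\<And>f. f \<in> S \<Longrightarrow> Comp C h (c f) = m f"
      and uniq: "\<And>h'. h' \<in> hom C L Z \<Longrightarrow> (\<And>f. f \<in> S \<Longrightarrow> Comp C h' (c f) = m f) \<Longrightarrow> h' = h"
      using colim m unfolding sieve_colimit_def by metis
    have transfer: "Comp C x f = Comp C (Comp C x k) (c f)"
      if "x \<in> hom C X Z" "f \<in> S" for x f
      using Comp_assoc[OF C c[OF that(2)] k that(1)] kc[OF that(2)] by simp
    have cancel: "Comp C (Comp C x k) k' = x" if "x \<in> hom C X Z" for x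
      using Comp_assoc[OF C k' k that] Comp_Ident[OF C that] kk' by simp
    have forth: "Comp C (Comp C h k') k = h"
      using Comp_assoc[OF C k k' h(1)] Comp_Ident[OF C h(1)] k'k by simp
    show ?thesis
    proof (intro ex1I[of _ "Comp C h k'"] conjI ballI)
      show hk': "Comp C h k' \<in> hom C X Z"
        using Comp_in_hom[OF C k' h(1)] .
      show "Comp C (Comp C h k') f = m f" if "f \<in> S" for f
        using transfer[OF hk' that] h(2)[OF that] forth by simp
    next
      fix x assume x: "x \<in> hom C X Z \<and> (\<forall>f\<in>S. Comp C x f = m f)"
      then have "Comp C x k = h"
        using uniq[of "Comp C x k"] Comp_in_hom[OF C k] transfer[of x] by simp
      then show "x = Comp C h k'"
        using cancel x by auto
    qed
  qed
  then show "effective_sieve C X S"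
    unfolding effective_sieve_def using S by (simp add: sieve_cocone_iff_matching_family[OF C S])
qed


section \<open>Morphisms of \<open>CGWH\<close>\<close>

lemma CGWH_Obj_iff:
  "X \<in> Obj (CGWH small) \<longleftrightarrow>
     small (topspace X) \<and> compactly_generated small X \<and> weakly_hausdorff small X"
  by (simp add: CGWH_def Let_def)

lemma CGWH_simps [simp]:
  "Dom (CGWH small) = source" "Cod (CGWH small) = target"
  "source (Comp (CGWH small) g f) = source f" "target (Comp (CGWH small) g f) = target g"
  "fn (Comp (CGWH small) g f) = compose (topspace (source f)) (fn g) (fn f)"
  "Ident (CGWH small) X = CMap X (\<lambda>x\<in>topspace X. x) X"
  by (simp_all add: CGWH_def Let_def)

lemma CGWH_hom_iff:
  "f \<in> hom (CGWH small) X Y \<longleftrightarrow> X \<in> Obj (CGWH small) \<and> Y \<in> Obj (CGWH small) \<and>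
     source f = X \<and> target f = Y \<and> continuous_map X Y (fn f) \<and> fn f \<in> extensional (topspace X)"
  by (auto simp: CGWH_def Let_def hom_def)

lemma CGWH_arrows_to_iff:
  "f \<in> arrows_to (CGWH small) X \<longleftrightarrow> f \<in> hom (CGWH small) (source f) X"
  by (simp add: arrows_to_iff_hom)

lemma CGWH_hom_funspace:
  "f \<in> hom (CGWH small) X Y \<Longrightarrow> x \<in> topspace X \<Longrightarrow> fn f x \<in> topspace Y"
  using continuous_map_funspace by (fastforce simp: CGWH_hom_iff)

lemma CGWH_hom_eqI:
  assumes "f \<in> hom (CGWH small) X Y" "g \<in> hom (CGWH small) X Y"
    "\<And>x. x \<in> topspace X \<Longrightarrow> fn f x = fn g x"
  shows "f = g"
  using assms extensionalityI[of "fn f" "topspace X" "fn g"]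
  by (auto simp: CGWH_hom_iff intro: cmap.expand)

text \<open>The morphism given by a map of which only the values on \<open>X\<close> matter.\<close>

definition cmap_on :: "'u topology \<Rightarrow> 'u topology \<Rightarrow> ('u \<Rightarrow> 'u) \<Rightarrow> 'u cmap" where
  "cmap_on X Y \<phi> = CMap X (restrict \<phi> (topspace X)) Y"

lemma cmap_on_simps [simp]:
  "source (cmap_on X Y \<phi>) = X" "target (cmap_on X Y \<phi>) = Y"
  "x \<in> topspace X \<Longrightarrow> fn (cmap_on X Y \<phi>) x = \<phi> x"
  by (simp_all add: cmap_on_def)

lemma cmap_on_in_hom:
  assumes "X \<in> Obj (CGWH small)" "Y \<in> Obj (CGWH small)" "continuous_map X Y \<phi>"
  shows "cmap_on X Y \<phi> \<in> hom (CGWH small) X Y"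
  using assms continuous_map_eq[OF assms(3)] by (simp add: CGWH_hom_iff cmap_on_def)

lemma test_space_in_CGWH: "test_space small K \<Longrightarrow> K \<in> Obj (CGWH small)"
  using test_space_compactly_generated test_space_weakly_hausdorff
  by (auto simp: CGWH_Obj_iff test_space_def)

lemma CGWH_iso_homeomorphic_map:
  assumes "iso (CGWH small) f"
  shows "homeomorphic_map (source f) (target f) (fn f)"
proof -
  obtain g where g: "g \<in> hom (CGWH small) (target f) (source f)"
    "Comp (CGWH small) g f = Ident (CGWH small) (source f)"
    "Comp (CGWH small) f g = Ident (CGWH small) (target f)" and "f \<in> Arr (CGWH small)"
    using assms by (auto simp: iso_def)
  then have f: "f \<in> hom (CGWH small) (source f) (target f)"
    by (simp add: hom_def)
  have gf: "fn g (fn f x) = x" if "x \<in> topspace (source f)" for x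
    using arg_cong[OF g(2), of "\<lambda>h. fn h x"] that by (simp add: compose_def)
  have fg: "fn f (fn g y) = y" if "y \<in> topspace (target f)" for y
    using arg_cong[OF g(3), of "\<lambda>h. fn h y"] that g(1) by (simp add: compose_def CGWH_hom_iff)
  show ?thesis
    unfolding homeomorphic_map_maps homeomorphic_maps_def
    using f g(1) gf fg by (auto simp: CGWH_hom_iff)
qed


section \<open>Jointly quotient families\<close>

text \<open>A set of arrows takes the place of an indexed family, because the notion is applied to sieves
  as well.\<close>

definition jointly_quotient :: "'u topology \<Rightarrow> 'u cmap set \<Rightarrow> bool" where
  "jointly_quotient X F \<longleftrightarrow>
     (\<forall>x\<in>topspace X. \<exists>f\<in>F. \<exists>a\<in>topspace (source f). fn f a = x) \<and>
     (\<forall>Z\<subseteq>topspace X. (\<forall>f\<in>F. closedin (source f) {a \<in> topspace (source f). fn f a \<in> Z}) \<longrightarrow>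
        closedin X Z)"

lemma coproduct_quotient_iff_jointly_quotient:
  assumes "\<And>i. i \<in> I \<Longrightarrow> f i \<in> arrows_to (CGWH small) X"
  shows "coproduct_quotient X I f \<longleftrightarrow> jointly_quotient X (f ` I)"
proof -
  have fi: "continuous_map (source (f i)) X (fn (f i))" if "i \<in> I" for i
    using assms[OF that] by (simp add: CGWH_arrows_to_iff CGWH_hom_iff)
  have closed: "closedin (sum_topology (\<lambda>i. source (f i)) I)
        {x \<in> topspace (sum_topology (\<lambda>i. source (f i)) I). (\<lambda>(i, a). fn (f i) a) x \<in> Z} \<longleftrightarrow>
      (\<forall>i\<in>I. closedin (source (f i)) {a \<in> topspace (source (f i)). fn (f i) a \<in> Z})" for Z
    unfolding closedin_sum_topology by (auto cong: conj_cong)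
  have onto: "(\<lambda>(i, a). fn (f i) a) ` topspace (sum_topology (\<lambda>i. source (f i)) I) = topspace X \<longleftrightarrow>
      (\<forall>x\<in>topspace X. \<exists>i\<in>I. \<exists>a\<in>topspace (source (f i)). fn (f i) a = x)"
    using continuous_map_funspace[OF fi] by (force simp: image_def Pi_iff)
  show ?thesis
    unfolding coproduct_quotient_def quotient_map_closedin closed onto jointly_quotient_def
    using closedin_continuous_map_preimage[OF fi] by auto
qed

text \<open>If \<open>f\<close> factors through \<open>g\<close>, then \<open>f\<close> hits no more points than \<open>g\<close>, and a set with closed
  preimage under \<open>g\<close> has closed preimage under \<open>f\<close>.\<close>

lemma jointly_quotient_refine:
  assumes "jointly_quotient X F"
    and factor: "\<And>f. f \<in> F \<Longrightarrow> \<exists>g\<in>G. \<exists>k. continuous_map (source f) (source g) k \<and>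
       (\<forall>a\<in>topspace (source f). fn f a = fn g (k a))"
  shows "jointly_quotient X G"
  unfolding jointly_quotient_def
proof (intro conjI ballI allI impI)
  fix x assume "x \<in> topspace X"
  then obtain f a where f: "f \<in> F" "a \<in> topspace (source f)" "fn f a = x"
    using assms(1) by (auto simp: jointly_quotient_def)
  then obtain g k where "g \<in> G" "continuous_map (source f) (source g) k" "fn f a = fn g (k a)"
    using factor by blast
  then show "\<exists>g\<in>G. \<exists>b\<in>topspace (source g). fn g b = x"
    using f continuous_map_funspace by (intro bexI[of _ g] bexI[of _ "k a"]) fastforce+
next
  fix Z assume Z: "Z \<subseteq> topspace X"
    and closed: "\<forall>g\<in>G. closedin (source g) {b \<in> topspace (source g). fn g b \<in> Z}"
  have "closedin (source f) {a \<in> topspace (source f). fn f a \<in> Z}" if f: "f \<in> F" for f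
  proof -
    obtain g k where g: "g \<in> G" and k: "continuous_map (source f) (source g) k"
      and eq: "\<And>a. a \<in> topspace (source f) \<Longrightarrow> fn f a = fn g (k a)"
      using factor[OF f] by blast
    have "{a \<in> topspace (source f). fn f a \<in> Z} =
        {a \<in> topspace (source f). k a \<in> {b \<in> topspace (source g). fn g b \<in> Z}}"
      using eq continuous_map_funspace[OF k] by auto
    then show ?thesis
      using closedin_continuous_map_preimage[OF k bspec[OF closed g]] by (simp only:)
  qed
  then show "closedin X Z"
    using assms(1) Z by (simp add: jointly_quotient_def)
qed

lemma jointly_quotient_mono:
  assumes "jointly_quotient X F" "F \<subseteq> G"
  shows "jointly_quotient X G"
proof (rule jointly_quotient_refine[OF assms(1)])
  fix f assume "f \<in> F"
  then show "\<exists>g\<in>G. \<exists>k. continuous_map (source f) (source g) k \<and>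
      (\<forall>a\<in>topspace (source f). fn f a = fn g (k a))"
    using assms(2) by (intro bexI[of _ f] exI[of _ id]) auto
qed

lemma jointly_quotient_iso:
  assumes "iso (CGWH small) f"
  shows "jointly_quotient (target f) {f}"
proof -
  have "quotient_map (source f) (target f) (fn f)"
    using CGWH_iso_homeomorphic_map[OF assms] by (simp add: homeomorphic_map_def)
  then have onto: "fn f ` topspace (source f) = topspace (target f)"
    and "\<And>Z. Z \<subseteq> topspace (target f) \<Longrightarrow>
      closedin (source f) {a \<in> topspace (source f). fn f a \<in> Z} = closedin (target f) Z"
    by (simp_all add: quotient_map_closedin)
  moreover have "\<exists>a\<in>topspace (source f). fn f a = y" if "y \<in> topspace (target f)" for y
    using that unfolding onto[symmetric] by blast
  ultimately show ?thesis
    by (simp add: jointly_quotient_def)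
qed

text \<open>The local character of quotient sieves; it also contains the fact that quotient maps
  compose.\<close>

lemma jointly_quotient_local:
  assumes F: "jointly_quotient X F"
    and H: "\<And>f. f \<in> F \<Longrightarrow> jointly_quotient (source f) (sieve_pullback (CGWH small) f H)"
  shows "jointly_quotient X H"
  unfolding jointly_quotient_def
proof (intro conjI ballI allI impI)
  fix x assume "x \<in> topspace X"
  then obtain f a where f: "f \<in> F" "a \<in> topspace (source f)" "fn f a = x"
    using F by (auto simp: jointly_quotient_def)
  moreover from f obtain g b where "g \<in> sieve_pullback (CGWH small) f H"
      "b \<in> topspace (source g)" "fn g b = a"
    using H[OF f(1)] by (auto simp: jointly_quotient_def)
  ultimately show "\<exists>h\<in>H. \<exists>b\<in>topspace (source h). fn h b = x"
    by (intro bexI[of _ "Comp (CGWH small) f g"] bexI[of _ b])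
      (auto simp: compose_def sieve_pullback_def)
next
  fix Z assume Z: "Z \<subseteq> topspace X"
    and closed: "\<forall>h\<in>H. closedin (source h) {b \<in> topspace (source h). fn h b \<in> Z}"
  have "closedin (source f) {a \<in> topspace (source f). fn f a \<in> Z}" if f: "f \<in> F" for f
  proof -
    have "closedin (source g) {b \<in> topspace (source g). fn g b \<in> {a \<in> topspace (source f). fn f a \<in> Z}}"
      if g: "g \<in> sieve_pullback (CGWH small) f H" for g
    proof -
      have gh: "g \<in> hom (CGWH small) (source g) (source f)" and fg: "Comp (CGWH small) f g \<in> H"
        using g by (auto simp: sieve_pullback_def CGWH_arrows_to_iff)
      have eq: "{b \<in> topspace (source g). fn g b \<in> {a \<in> topspace (source f). fn f a \<in> Z}} =
          {b \<in> topspace (source g). fn (Comp (CGWH small) f g) b \<in> Z}"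
        using CGWH_hom_funspace[OF gh] by (auto simp: compose_def)
      show ?thesis
        unfolding eq using bspec[OF closed fg] by simp
    qed
    moreover have "{a \<in> topspace (source f). fn f a \<in> Z} \<subseteq> topspace (source f)"
      by blast
    ultimately show ?thesis
      using conjunct2[OF H[OF f, unfolded jointly_quotient_def]] by simp
  qed
  then show "closedin X Z"
    using F Z by (simp add: jointly_quotient_def)
qed


section \<open>Stability of quotient sieves under pullback\<close>

lemma sieve_pullback_CGWH_I:
  assumes "h \<in> hom (CGWH small) W Y" "Comp (CGWH small) \<alpha> h \<in> S" "source \<alpha> = Y"
  shows "h \<in> sieve_pullback (CGWH small) \<alpha> S"
  using assms by (auto simp: sieve_pullback_def CGWH_arrows_to_iff CGWH_hom_iff)

lemma Comp_cmap_on: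
  assumes "\<And>x. x \<in> topspace W \<Longrightarrow> \<phi> x \<in> topspace (source g) \<and> fn g (\<phi> x) = \<psi> x"
  shows "Comp (CGWH small) g (cmap_on W (source g) \<phi>) = cmap_on W (target g) \<psi>"
  using assms by (auto simp: CGWH_def Let_def cmap_on_def compose_def restrict_def fun_eq_iff)

context sizes
begin

lemma singleton_test_space: "test_space small (discrete_topology {a})"
  by (simp add: test_space_def small_singleton compact_space_discrete_topology)

text \<open>Let \<open>Z \<subseteq> Y\<close> have closed preimages under the pulled back sieve.  As \<open>Y\<close> is compactly generated,
  it is enough that \<open>W = u\<^sup>-\<^sup>1 Z\<close> is closed for every test map \<open>u: K \<rightarrow> Y\<close>.  Put \<open>v = \<alpha> \<circ> u\<close>.
  For a test space \<open>L\<close> with a map \<open>L \<rightarrow> X\<close> in \<open>S\<close>, the fibre product \<open>P\<close> of \<open>K\<close> and \<open>L\<close> over \<open>X\<close>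
  is compact Hausdorff, its projections are closed maps, and the map \<open>P \<rightarrow> K \<rightarrow> Y\<close> belongs to the
  pulled back sieve, so that the preimage of \<open>W\<close> in \<open>P\<close> is closed.  Projecting to \<open>K\<close>, with \<open>L\<close> a
  point, shows that \<open>W\<close> meets the fibres of \<open>v\<close> in closed sets.  Projecting to \<open>L\<close> shows that
  \<open>v(N \<inter> W)\<close> is closed in \<open>X\<close> for every closed \<open>N \<subseteq> K\<close>.  Now a point \<open>k\<^sub>0\<close> outside \<open>W\<close> has, by
  regularity of \<open>K\<close>, a closed neighbourhood \<open>N\<close> that misses the intersection of \<open>W\<close> with the fibre
  of \<open>k\<^sub>0\<close>.  Then \<open>v k\<^sub>0\<close> is not in \<open>v(N \<inter> W)\<close>, and the points of \<open>N\<close> that \<open>v\<close> maps outside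
  this closed set form a neighbourhood of \<open>k\<^sub>0\<close> disjoint from \<open>W\<close>.\<close>

lemma jointly_quotient_sieve_pullback:
  assumes S: "sieve (CGWH small) X S" and quot: "jointly_quotient X S"
    and \<alpha>: "\<alpha> \<in> hom (CGWH small) Y X"
  shows "jointly_quotient Y (sieve_pullback (CGWH small) \<alpha> S)"
proof -
  have X: "X \<in> Obj (CGWH small)" and Y: "Y \<in> Obj (CGWH small)"
    and src: "source \<alpha> = Y" "target \<alpha> = X" and \<alpha>c: "continuous_map Y X (fn \<alpha>)"
    using \<alpha> by (auto simp: CGWH_hom_iff)
  have inS: "f \<in> hom (CGWH small) (source f) X" if "f \<in> S" for f
    using sieve_in_hom[OF S that] by simp
  have restrict: "cmap_on L X (\<lambda>l. fn f (w l)) \<in> S"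
    if f: "f \<in> S" and L: "L \<in> Obj (CGWH small)" and w: "continuous_map L (source f) w" for f L w
  proof -
    have "Comp (CGWH small) f (cmap_on L (source f) w) \<in> S"
      using sieve_Comp[OF S f, of _ L] cmap_on_in_hom[OF L _ w] inS[OF f]
      by (simp add: CGWH_hom_iff)
    moreover have "Comp (CGWH small) f (cmap_on L (source f) w) = cmap_on L X (\<lambda>l. fn f (w l))"
      using Comp_cmap_on[of L w f "\<lambda>l. fn f (w l)" small] continuous_map_funspace[OF w] inS[OF f]
      by (auto simp: CGWH_hom_iff)
    ultimately show ?thesis
      by simp
  qed
  have lift: "cmap_on L Y w \<in> sieve_pullback (CGWH small) \<alpha> S"
    if L: "L \<in> Obj (CGWH small)" and w: "continuous_map L Y w"
      and mem: "cmap_on L X \<psi> \<in> S" and eq: "\<And>l. l \<in> topspace L \<Longrightarrow> fn \<alpha> (w l) = \<psi> l" for L w \<psi>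
  proof -
    have "Comp (CGWH small) \<alpha> (cmap_on L Y w) = cmap_on L X \<psi>"
      using Comp_cmap_on[of L w \<alpha> \<psi> small] continuous_map_funspace[OF w] eq src by auto
    then show ?thesis
      using sieve_pullback_CGWH_I[OF cmap_on_in_hom[OF L Y w], of \<alpha>] mem src by simp
  qed
  have closed_Y: "closedin Y Z"
    if Z: "Z \<subseteq> topspace Y"
      and closed: "\<And>h. h \<in> sieve_pullback (CGWH small) \<alpha> S \<Longrightarrow>
        closedin (source h) {a \<in> topspace (source h). fn h a \<in> Z}" for Z
  proof -
    have "closedin K {k \<in> topspace K. u k \<in> Z}"
      if K: "test_space small K" and u: "continuous_map K Y u" for K u
    proof -
      define W where "W = {k \<in> topspace K. u k \<in> Z}"
      define v where "v = fn \<alpha> \<circ> u"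
      have v: "continuous_map K X v"
        unfolding v_def using continuous_map_compose[OF u \<alpha>c] .
      have WK: "W \<subseteq> topspace K"
        by (auto simp: W_def)
      have pull: "\<exists>(P :: 'u topology) p q. closed_map P K p \<and> closed_map P L q \<and> continuous_map P K p \<and>
          closedin P {z \<in> topspace P. p z \<in> W} \<and>
          (\<forall>z\<in>topspace P. q z \<in> topspace L \<and> v (p z) = \<phi> (q z)) \<and>
          (\<forall>k\<in>topspace K. \<forall>l\<in>topspace L. v k = \<phi> l \<longrightarrow> (\<exists>z\<in>topspace P. p z = k \<and> q z = l))"
        if L: "test_space small L" and \<phi>: "continuous_map L X \<phi>" and mem: "cmap_on L X \<phi> \<in> S"
        for L \<phi>
      proof -
        have "weakly_hausdorff small X"
          using X by (simp add: CGWH_Obj_iff)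
        then obtain P p q where P: "test_space small P"
          and p: "continuous_map P K p" and q: "continuous_map P L q"
          and comm: "\<And>z. z \<in> topspace P \<Longrightarrow> v (p z) = \<phi> (q z)"
          and ex: "\<And>k l. k \<in> topspace K \<Longrightarrow> l \<in> topspace L \<Longrightarrow> v k = \<phi> l \<Longrightarrow>
             \<exists>z\<in>topspace P. p z = k \<and> q z = l"
          using compact_pullback[OF sizes_axioms K L _ v \<phi>] by metis
        have "cmap_on P X (\<lambda>z. fn (cmap_on L X \<phi>) (q z)) \<in> S"
          using restrict[OF mem test_space_in_CGWH[OF P]] q by simp
        then have "cmap_on P Y (u \<circ> p) \<in> sieve_pullback (CGWH small) \<alpha> S"
          using lift[OF test_space_in_CGWH[OF P] continuous_map_compose[OF p u]] comm
            continuous_map_funspace[OF q] by (auto simp: v_def Pi_iff)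
        then have "closedin P {z \<in> topspace P. p z \<in> W}"
          using closed[of "cmap_on P Y (u \<circ> p)"] continuous_map_funspace[OF p]
          by (simp add: W_def Pi_iff cong: conj_cong)
        moreover have "closed_map P K p" "closed_map P L q"
          using P K L p q by (auto simp: test_space_def intro: continuous_imp_closed_map)
        moreover have "q z \<in> topspace L" if "z \<in> topspace P" for z
          using continuous_map_funspace[OF q] that by auto
        ultimately show ?thesis
          using p comm ex by (intro exI[of _ P] exI[of _ p] exI[of _ q]) blast
      qed
      have fibre: "closedin K {k \<in> W. v k = v k0}" if k0: "k0 \<in> topspace K" for k0
      proof -
        have "v k0 \<in> topspace X"
          using continuous_map_funspace[OF v] k0 by auto
        then obtain f a where f: "f \<in> S" and a: "a \<in> topspace (source f)" "fn f a = v k0"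
          using quot by (auto simp: jointly_quotient_def)
        let ?L = "discrete_topology {a}"
        have "continuous_map ?L (source f) (\<lambda>l. l)"
          using a by simp
        then have mem: "cmap_on ?L X (fn f) \<in> S"
          using restrict[OF f test_space_in_CGWH[OF singleton_test_space]] by simp
        have \<phi>: "continuous_map ?L X (fn f)"
          using a continuous_map_funspace[OF v] k0 by auto
        obtain P :: "'u topology" and p q where "closed_map P K p" "closedin P {z \<in> topspace P. p z \<in> W}"
          "\<forall>z\<in>topspace P. q z \<in> topspace ?L \<and> v (p z) = fn f (q z)"
          "\<forall>k\<in>topspace K. \<forall>l\<in>topspace ?L. v k = fn f l \<longrightarrow> (\<exists>z\<in>topspace P. p z = k \<and> q z = l)"
          using pull[OF singleton_test_space \<phi> mem] by blast
        moreover from this have "p ` {z \<in> topspace P. p z \<in> W} = {k \<in> W. v k = v k0}"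
          using a WK by (fastforce simp: image_iff)
        ultimately show ?thesis
          unfolding closed_map_def by metis
      qed
      have image: "closedin X (v ` (N \<inter> W))" if N: "closedin K N" for N
      proof -
        have "closedin (source f) {a \<in> topspace (source f). fn f a \<in> v ` (N \<inter> W)}"
          if f: "f \<in> S" for f
        proof -
          have "closedin L {l \<in> topspace L. w l \<in> {a \<in> topspace (source f). fn f a \<in> v ` (N \<inter> W)}}"
            if L: "test_space small L" and w: "continuous_map L (source f) w" for L w
          proof -
            have \<phi>: "continuous_map L X (\<lambda>l. fn f (w l))"
              using continuous_map_compose[OF w, of X "fn f"] inS[OF f]
              by (simp add: CGWH_hom_iff o_def)
            obtain P :: "'u topology" and p q where q: "closed_map P L q" and p: "continuous_map P K p"
              and W: "closedin P {z \<in> topspace P. p z \<in> W}"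
              and comm: "\<forall>z\<in>topspace P. q z \<in> topspace L \<and> v (p z) = fn f (w (q z))"
              and ex: "\<forall>k\<in>topspace K. \<forall>l\<in>topspace L. v k = fn f (w l) \<longrightarrow>
                (\<exists>z\<in>topspace P. p z = k \<and> q z = l)"
              using pull[OF L \<phi> restrict[OF f test_space_in_CGWH[OF L] w]] by blast
            have "closedin P ({z \<in> topspace P. p z \<in> N} \<inter> {z \<in> topspace P. p z \<in> W})"
              using closedin_continuous_map_preimage[OF p N] W by blast
            then have "closedin L (q ` ({z \<in> topspace P. p z \<in> N} \<inter> {z \<in> topspace P. p z \<in> W}))"
              using q unfolding closed_map_def by blast
            moreover have "q ` ({z \<in> topspace P. p z \<in> N} \<inter> {z \<in> topspace P. p z \<in> W}) =
                {l \<in> topspace L. w l \<in> {a \<in> topspace (source f). fn f a \<in> v ` (N \<inter> W)}}"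
            proof (intro equalityI subsetI)
              fix l assume "l \<in> {l \<in> topspace L. w l \<in> {a \<in> topspace (source f). fn f a \<in> v ` (N \<inter> W)}}"
              then obtain k where "l \<in> topspace L" "k \<in> N" "k \<in> W" "v k = fn f (w l)"
                by auto
              then show "l \<in> q ` ({z \<in> topspace P. p z \<in> N} \<inter> {z \<in> topspace P. p z \<in> W})"
                using ex WK by blast
            next
              fix l assume "l \<in> q ` ({z \<in> topspace P. p z \<in> N} \<inter> {z \<in> topspace P. p z \<in> W})"
              then obtain z where z: "z \<in> topspace P" "p z \<in> N" "p z \<in> W" "l = q z"
                by blast
              then have "l \<in> topspace L" "fn f (w l) = v (p z)"
                using comm by auto
              then show "l \<in> {l \<in> topspace L. w l \<in> {a \<in> topspace (source f). fn f a \<in> v ` (N \<inter> W)}}"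
                using z continuous_map_funspace[OF w] by auto
            qed
            ultimately show ?thesis
              by simp
          qed
          then have "k_closed small (source f) {a \<in> topspace (source f). fn f a \<in> v ` (N \<inter> W)}"
            by (simp add: k_closed_iff)
          then show ?thesis
            using inS[OF f] by (simp add: CGWH_hom_iff CGWH_Obj_iff compactly_generated_def)
        qed
        moreover have "v ` (N \<inter> W) \<subseteq> topspace X"
          using continuous_map_funspace[OF v] WK by auto
        ultimately show ?thesis
          using quot unfolding jointly_quotient_def by blast
      qed
      have "\<exists>U. openin K U \<and> k0 \<in> U \<and> U \<subseteq> topspace K - W" if k0: "k0 \<in> topspace K - W" for k0
      proof -
        have "regular_space K"
          using K by (simp add: test_space_def compact_Hausdorff_imp_regular_space)
        moreover have "closedin K {k \<in> W. v k = v k0}" "k0 \<in> topspace K - {k \<in> W. v k = v k0}"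
          using fibre k0 by auto
        ultimately obtain U V where U: "openin K U" "k0 \<in> U" and V: "openin K V"
          and sub: "{k \<in> W. v k = v k0} \<subseteq> V" and disj: "disjnt U V"
          unfolding regular_space_def by meson
        \<comment> \<open>The closed neighbourhood \<open>N\<close> of \<open>k0\<close> is the complement of \<open>V\<close>; it contains \<open>U\<close>.\<close>
        let ?D = "v ` ((topspace K - V) \<inter> W)"
        have "openin X (topspace X - ?D)"
          using image V by blast
        then have "openin K {k \<in> topspace K. v k \<in> topspace X - ?D}"
          by (rule openin_continuous_map_preimage[OF v])
        then have "openin K (U \<inter> {k \<in> topspace K. v k \<in> topspace X - ?D})"
          using U(1) by blast
        moreover have "k0 \<in> U \<inter> {k \<in> topspace K. v k \<in> topspace X - ?D}"
          using U(2) k0 sub continuous_map_funspace[OF v] by auto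
        moreover have "U \<inter> {k \<in> topspace K. v k \<in> topspace X - ?D} \<subseteq> topspace K - W"
          using disj by (auto simp: disjnt_iff)
        ultimately show ?thesis
          by blast
      qed
      then have "openin K (topspace K - W)"
        by (subst openin_subopen) blast
      then show ?thesis
        using WK unfolding W_def[symmetric] closedin_def by blast
    qed
    then have "k_closed small Y Z"
      using Z by (simp add: k_closed_iff)
    then show ?thesis
      using Y by (simp add: CGWH_Obj_iff compactly_generated_def)
  qed
  have onto: "\<exists>h\<in>sieve_pullback (CGWH small) \<alpha> S. \<exists>b\<in>topspace (source h). fn h b = y"
    if y: "y \<in> topspace Y" for y
  proof -
    let ?L = "discrete_topology {y}"
    have "fn \<alpha> y \<in> topspace X"
      using CGWH_hom_funspace[OF \<alpha> y] .
    then obtain f a where f: "f \<in> S" and a: "a \<in> topspace (source f)" "fn f a = fn \<alpha> y"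
      using quot by (auto simp: jointly_quotient_def)
    have L: "?L \<in> Obj (CGWH small)"
      using test_space_in_CGWH[OF singleton_test_space] .
    have "cmap_on ?L X (\<lambda>l. fn f a) \<in> S"
      using restrict[OF f L, of "\<lambda>_. a"] a by simp
    then have "cmap_on ?L Y (\<lambda>l. l) \<in> sieve_pullback (CGWH small) \<alpha> S"
      by (rule lift[OF L, rotated]) (use y a in auto)
    then show ?thesis
      by (intro bexI[of _ "cmap_on ?L Y (\<lambda>l. l)"] bexI[of _ y]) auto
  qed
  show ?thesis
    unfolding jointly_quotient_def using onto closed_Y by blast
qed

end


section \<open>Colim sieves are quotient sieves\<close>

definition sieve_image :: "'u cmap set \<Rightarrow> 'u set" where
  "sieve_image S = (\<Union>f\<in>S. fn f ` topspace (source f))"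

text \<open>This space turns out to be the colimit of the sieve in \<open>CGWH\<close>.\<close>

definition final_topology :: "'u cmap set \<Rightarrow> 'u topology" where
  "final_topology S = topology (\<lambda>U. U \<subseteq> sieve_image S \<and>
     (\<forall>f\<in>S. openin (source f) {a \<in> topspace (source f). fn f a \<in> U}))"

lemma openin_final_topology:
  "openin (final_topology S) U \<longleftrightarrow> U \<subseteq> sieve_image S \<and>
     (\<forall>f\<in>S. openin (source f) {a \<in> topspace (source f). fn f a \<in> U})"
proof -
  have Int: "{a \<in> topspace (source f). fn f a \<in> U \<inter> V} =
      {a \<in> topspace (source f). fn f a \<in> U} \<inter> {a \<in> topspace (source f). fn f a \<in> V}"
    for f :: "'u cmap" and U V
    by auto
  have Un: "{a \<in> topspace (source f). fn f a \<in> \<Union>\<U>} =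
      (\<Union>U\<in>\<U>. {a \<in> topspace (source f). fn f a \<in> U})" for f :: "'u cmap" and \<U>
    by auto
  have "istopology (\<lambda>U. U \<subseteq> sieve_image S \<and>
      (\<forall>f\<in>S. openin (source f) {a \<in> topspace (source f). fn f a \<in> U}))"
    unfolding istopology_def
  proof (intro conjI allI impI)
    fix \<U> assume "\<forall>U\<in>\<U>. U \<subseteq> sieve_image S \<and>
      (\<forall>f\<in>S. openin (source f) {a \<in> topspace (source f). fn f a \<in> U})"
    then show "\<Union>\<U> \<subseteq> sieve_image S"
      "\<forall>f\<in>S. openin (source f) {a \<in> topspace (source f). fn f a \<in> \<Union>\<U>}"
      unfolding Un by blast+
  next
    fix U V assume "U \<subseteq> sieve_image S \<and>
        (\<forall>f\<in>S. openin (source f) {a \<in> topspace (source f). fn f a \<in> U})"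
      "V \<subseteq> sieve_image S \<and>
        (\<forall>f\<in>S. openin (source f) {a \<in> topspace (source f). fn f a \<in> V})"
    then show "U \<inter> V \<subseteq> sieve_image S"
      "\<forall>f\<in>S. openin (source f) {a \<in> topspace (source f). fn f a \<in> U \<inter> V}"
      unfolding Int by (blast intro: openin_Int)+
  qed
  then show ?thesis
    unfolding final_topology_def by (simp add: topology_inverse')
qed

lemma topspace_final_topology [simp]: "topspace (final_topology S) = sieve_image S"
proof (rule antisym)
  have "{a \<in> topspace (source f). fn f a \<in> sieve_image S} = topspace (source f)" if "f \<in> S" for f
    using that by (auto simp: sieve_image_def)
  then have "openin (final_topology S) (sieve_image S)"
    by (simp add: openin_final_topology)
  then show "sieve_image S \<subseteq> topspace (final_topology S)"
    by (rule openin_subset)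
  show "topspace (final_topology S) \<subseteq> sieve_image S"
    using openin_topspace[of "final_topology S"] unfolding openin_final_topology by blast
qed

lemma closedin_final_topology:
  "closedin (final_topology S) C \<longleftrightarrow> C \<subseteq> sieve_image S \<and>
     (\<forall>f\<in>S. closedin (source f) {a \<in> topspace (source f). fn f a \<in> C})"
proof -
  have "{a \<in> topspace (source f). fn f a \<in> sieve_image S - C} =
      topspace (source f) - {a \<in> topspace (source f). fn f a \<in> C}" if "f \<in> S" for f
    using that by (auto simp: sieve_image_def)
  then show ?thesis
    by (auto simp: closedin_def openin_final_topology)
qed

lemma continuous_map_final_topology: "f \<in> S \<Longrightarrow> continuous_map (source f) (final_topology S) (fn f)"
  by (auto simp: continuous_map_closedin closedin_final_topology sieve_image_def)

lemma continuous_map_final_topology_inclusion: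
  assumes "\<And>f. f \<in> S \<Longrightarrow> continuous_map (source f) X (fn f)"
  shows "continuous_map (final_topology S) X (\<lambda>x. x)"
  unfolding continuous_map_closedin closedin_final_topology
proof (intro conjI allI impI ballI)
  show "(\<lambda>x. x) \<in> topspace (final_topology S) \<rightarrow> topspace X"
    using continuous_map_funspace[OF assms] by (auto simp: sieve_image_def)
next
  fix C f assume C: "closedin X C" and f: "f \<in> S"
  have "{a \<in> topspace (source f). fn f a \<in> {x \<in> topspace (final_topology S). x \<in> C}} =
      {a \<in> topspace (source f). fn f a \<in> C}"
    using f by (auto simp: sieve_image_def)
  then show "closedin (source f)
      {a \<in> topspace (source f). fn f a \<in> {x \<in> topspace (final_topology S). x \<in> C}}"
    using closedin_continuous_map_preimage[OF assms[OF f] C] by simp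
qed auto

context sizes
begin

text \<open>Compact generation passes from the sources to the final topology, and weak Hausdorffness comes
  from the inclusion into \<open>X\<close>.\<close>

lemma final_topology_in_CGWH:
  assumes X: "X \<in> Obj (CGWH small)" and S: "\<And>f. f \<in> S \<Longrightarrow> f \<in> hom (CGWH small) (source f) X"
  shows "final_topology S \<in> Obj (CGWH small)"
proof -
  have c: "continuous_map (source f) X (fn f)" if "f \<in> S" for f
    using S[OF that] by (simp add: CGWH_hom_iff)
  have incl: "continuous_map (final_topology S) X (\<lambda>x. x)"
    using continuous_map_final_topology_inclusion c by blast
  have "small (topspace (final_topology S))"
    using small_subset[of "topspace X"] X continuous_map_funspace[OF incl]
    by (auto simp: CGWH_Obj_iff)
  moreover have "weakly_hausdorff small (final_topology S)"
    by (rule weakly_hausdorff_injective[OF _ incl]) (use X in \<open>auto simp: CGWH_Obj_iff\<close>)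
  moreover have "compactly_generated small (final_topology S)"
    unfolding compactly_generated_def
  proof (intro allI impI)
    fix C assume C: "k_closed small (final_topology S) C"
    have "closedin (source f) {a \<in> topspace (source f). fn f a \<in> C}" if f: "f \<in> S" for f
      using k_closed_continuous_preimage[OF C continuous_map_final_topology[OF f]] S[OF f]
      by (simp add: CGWH_hom_iff CGWH_Obj_iff compactly_generated_def)
    then show "closedin (final_topology S) C"
      using C by (auto simp: closedin_final_topology k_closed_iff)
  qed
  ultimately show ?thesis
    by (simp add: CGWH_Obj_iff)
qed

text \<open>A matching family glues to a map on \<open>X\<close>, which is automatically continuous, once its
  members agree at any two points \<open>a\<close>, \<open>a'\<close> with the same image in \<open>X\<close>.  These points are maps from
  a one-point space, and their composites with \<open>f\<close> and \<open>f'\<close> are one and the same member of the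
  sieve.\<close>

lemma jointly_quotient_imp_effective:
  assumes X: "X \<in> Obj (CGWH small)" and S: "sieve (CGWH small) X S" and quot: "jointly_quotient X S"
  shows "effective_sieve (CGWH small) X S"
  unfolding effective_sieve_def
proof (intro conjI ballI allI impI)
  show "sieve (CGWH small) X S"
    by (fact S)
next
  fix Z m
  assume Z: "Z \<in> Obj (CGWH small)"
    and "matching_family (CGWH small) (\<lambda>Y. hom (CGWH small) Y Z) (\<lambda>g h. Comp (CGWH small) h g) S m"
  then have m: "\<And>f. f \<in> S \<Longrightarrow> m f \<in> hom (CGWH small) (source f) Z"
    and match: "\<And>f g. f \<in> S \<Longrightarrow> g \<in> arrows_to (CGWH small) (source f) \<Longrightarrow>
      Comp (CGWH small) (m f) g = m (Comp (CGWH small) f g)"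
    by (auto simp: matching_family_def)
  have inS: "f \<in> hom (CGWH small) (source f) X" if "f \<in> S" for f
    using sieve_in_hom[OF S that] by simp
  have well_defined: "fn (m f) a = fn (m f') a'"
    if f: "f \<in> S" "a \<in> topspace (source f)" and f': "f' \<in> S" "a' \<in> topspace (source f')"
      and eq: "fn f a = fn f' a'" for f f' a a'
  proof -
    let ?L = "discrete_topology {a}"
    let ?g = "cmap_on ?L (source f) (\<lambda>_. a)" and ?g' = "cmap_on ?L (source f') (\<lambda>_. a')"
    have L: "?L \<in> Obj (CGWH small)"
      using test_space_in_CGWH[OF singleton_test_space] .
    have g: "?g \<in> arrows_to (CGWH small) (source f)" "?g' \<in> arrows_to (CGWH small) (source f')"
      using f f' cmap_on_in_hom[OF L] inS L by (simp_all add: CGWH_arrows_to_iff CGWH_hom_iff)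
    have "Comp (CGWH small) f ?g = cmap_on ?L (target f) (\<lambda>_. fn f a)"
      by (rule Comp_cmap_on) (use f in simp)
    moreover have "Comp (CGWH small) f' ?g' = cmap_on ?L (target f') (\<lambda>_. fn f a)"
      by (rule Comp_cmap_on) (use f' eq in simp)
    moreover have "target f = target f'"
      using inS f f' by (simp add: CGWH_hom_iff)
    ultimately have "Comp (CGWH small) (m f) ?g = Comp (CGWH small) (m f') ?g'"
      using match f(1) f'(1) g by simp
    then have "fn (Comp (CGWH small) (m f) ?g) a = fn (Comp (CGWH small) (m f') ?g') a"
      by (rule arg_cong)
    then show ?thesis
      by (simp add: compose_def)
  qed
  have "\<forall>x\<in>topspace X. \<exists>z. \<forall>f\<in>S. \<forall>a\<in>topspace (source f). fn f a = x \<longrightarrow> fn (m f) a = z"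
    using well_defined by blast
  then obtain \<xi> where \<xi>: "\<And>f a. f \<in> S \<Longrightarrow> a \<in> topspace (source f) \<Longrightarrow> fn (m f) a = \<xi> (fn f a)"
    using CGWH_hom_funspace[OF inS] by (metis (no_types, lifting) bchoice)
  have onto: "\<exists>f\<in>S. \<exists>a\<in>topspace (source f). fn f a = x" if "x \<in> topspace X" for x
    using quot that by (auto simp: jointly_quotient_def)
  have "continuous_map X Z \<xi>"
    unfolding continuous_map_closedin
  proof (intro conjI allI impI)
    show "\<xi> \<in> topspace X \<rightarrow> topspace Z"
      using onto \<xi> CGWH_hom_funspace[OF m] by (metis Pi_I')
  next
    fix C assume C: "closedin Z C"
    have "closedin (source f) {a \<in> topspace (source f). fn f a \<in> {x \<in> topspace X. \<xi> x \<in> C}}"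
      if f: "f \<in> S" for f
    proof -
      have eq: "{a \<in> topspace (source f). fn f a \<in> {x \<in> topspace X. \<xi> x \<in> C}} =
          {a \<in> topspace (source f). fn (m f) a \<in> C}"
        using \<xi>[OF f] CGWH_hom_funspace[OF inS[OF f]] by auto
      have "continuous_map (source f) Z (fn (m f))"
        using m[OF f] by (simp add: CGWH_hom_iff)
      then show ?thesis
        unfolding eq using C by (rule closedin_continuous_map_preimage)
    qed
    moreover have "{x \<in> topspace X. \<xi> x \<in> C} \<subseteq> topspace X"
      by blast
    ultimately show "closedin X {x \<in> topspace X. \<xi> x \<in> C}"
      using conjunct2[OF quot[unfolded jointly_quotient_def]] by simp
  qed
  then have x: "cmap_on X Z \<xi> \<in> hom (CGWH small) X Z"
    using cmap_on_in_hom X Z by blast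
  show "\<exists>!x. x \<in> hom (CGWH small) X Z \<and> (\<forall>f\<in>S. Comp (CGWH small) x f = m f)"
  proof (intro ex1I[of _ "cmap_on X Z \<xi>"] conjI ballI x)
    fix f assume f: "f \<in> S"
    show "Comp (CGWH small) (cmap_on X Z \<xi>) f = m f"
    proof (rule CGWH_hom_eqI)
      show "Comp (CGWH small) (cmap_on X Z \<xi>) f \<in> hom (CGWH small) (source f) Z"
        using Comp_in_hom[OF category_CGWH inS[OF f] x] .
      show "m f \<in> hom (CGWH small) (source f) Z"
        using m[OF f] .
      show "fn (Comp (CGWH small) (cmap_on X Z \<xi>) f) a = fn (m f) a" if "a \<in> topspace (source f)" for a
        using that CGWH_hom_funspace[OF inS[OF f] that] \<xi>[OF f that] by (simp add: compose_def)
    qed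
  next
    fix y assume y: "y \<in> hom (CGWH small) X Z \<and> (\<forall>f\<in>S. Comp (CGWH small) y f = m f)"
    show "y = cmap_on X Z \<xi>"
    proof (rule CGWH_hom_eqI)
      show "fn y p = fn (cmap_on X Z \<xi>) p" if p: "p \<in> topspace X" for p
      proof -
        obtain f a where f: "f \<in> S" "a \<in> topspace (source f)" "fn f a = p"
          using onto[OF p] by blast
        have "fn (Comp (CGWH small) y f) a = fn (m f) a"
          using y f(1) by simp
        then show ?thesis
          using f p \<xi>[OF f(1,2)] by (simp add: compose_def)
      qed
    qed (use x y in auto)
  qed
qed

text \<open>The corestrictions of the members of \<open>S\<close> to the final topology form a cocone, and so factor
  through a map \<open>r\<close> from \<open>X\<close> to the final topology.  Followed by the inclusion, \<open>r\<close> fixes all members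
  of \<open>S\<close>, so it is the identity on points; hence the final topology is all of \<open>X\<close>.\<close>

lemma effective_imp_jointly_quotient:
  assumes X: "X \<in> Obj (CGWH small)" and eff: "effective_sieve (CGWH small) X S"
  shows "jointly_quotient X S"
proof -
  have S: "sieve (CGWH small) X S"
    using eff by (simp add: effective_sieve_def)
  have amalgam: "\<exists>!x. x \<in> hom (CGWH small) X Z \<and> (\<forall>f\<in>S. Comp (CGWH small) x f = m f)"
    if "sieve_cocone (CGWH small) S Z m" for Z m
    using that eff unfolding effective_sieve_def sieve_cocone_iff_matching_family[OF category_CGWH S]
    by blast
  let ?T = "final_topology S"
  have inS: "f \<in> hom (CGWH small) (source f) X" if "f \<in> S" for f
    using sieve_in_hom[OF S that] by simp
  have T: "?T \<in> Obj (CGWH small)"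
    using final_topology_in_CGWH[OF X inS] .
  define m where "m f = cmap_on (source f) ?T (fn f)" for f
  have m: "m f \<in> hom (CGWH small) (source f) ?T" if "f \<in> S" for f
    unfolding m_def using cmap_on_in_hom[OF _ T continuous_map_final_topology[OF that]] inS[OF that]
    by (simp add: CGWH_hom_iff)
  have "sieve_cocone (CGWH small) S ?T m"
    unfolding sieve_cocone_def
  proof (intro conjI ballI impI T)
    show "m f \<in> hom (CGWH small) (Dom (CGWH small) f) ?T" if "f \<in> S" for f
      using m[OF that] by simp
  next
    fix f f' g
    assume f: "f \<in> S" and f': "f' \<in> S" and g: "g \<in> hom (CGWH small) (Dom (CGWH small) f') (Dom (CGWH small) f)"
      and eq: "Comp (CGWH small) f g = f'"
    show "Comp (CGWH small) (m f) g = m f'"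
    proof (rule CGWH_hom_eqI)
      show "Comp (CGWH small) (m f) g \<in> hom (CGWH small) (source f') ?T"
        using Comp_in_hom[OF category_CGWH _ m[OF f]] g by simp
      show "m f' \<in> hom (CGWH small) (source f') ?T"
        using m[OF f'] .
      show "fn (Comp (CGWH small) (m f) g) a = fn (m f') a" if a: "a \<in> topspace (source f')" for a
        using a g CGWH_hom_funspace[OF g, of a] unfolding eq[symmetric] m_def
        by (simp add: compose_def CGWH_hom_iff)
    qed
  qed
  then obtain r where r: "r \<in> hom (CGWH small) X ?T"
    and rf: "\<And>f. f \<in> S \<Longrightarrow> Comp (CGWH small) r f = m f"
    using amalgam by blast
  have incl: "continuous_map ?T X (\<lambda>x. x)"
    using continuous_map_final_topology_inclusion[of S X] inS by (simp add: CGWH_hom_iff)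
  define e where "e = cmap_on ?T X (\<lambda>x. x)"
  have e: "e \<in> hom (CGWH small) ?T X"
    unfolding e_def using cmap_on_in_hom[OF T X incl] .
  have er: "Comp (CGWH small) e r \<in> hom (CGWH small) X X"
    using Comp_in_hom[OF category_CGWH r e] .
  have "Comp (CGWH small) (Comp (CGWH small) e r) f = f" if f: "f \<in> S" for f
  proof (rule CGWH_hom_eqI[OF Comp_in_hom[OF category_CGWH inS[OF f] er] inS[OF f]])
    fix a assume a: "a \<in> topspace (source f)"
    have "fn r (fn f a) = fn f a"
      using arg_cong[OF rf[OF f], of "\<lambda>h. fn h a"] a by (simp add: compose_def m_def)
    moreover have "fn f a \<in> topspace X" "fn f a \<in> topspace ?T"
      using CGWH_hom_funspace[OF inS[OF f] a] f a by (auto simp: sieve_image_def)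
    moreover have "source r = X"
      using r by (simp add: CGWH_hom_iff)
    ultimately show "fn (Comp (CGWH small) (Comp (CGWH small) e r) f) a = fn f a"
      using a by (simp add: compose_def e_def)
  qed
  moreover have "sieve_cocone (CGWH small) S X (\<lambda>f. f)"
    using X inS by (simp add: sieve_cocone_def)
  moreover have "Comp (CGWH small) (Ident (CGWH small) X) f = f" if "f \<in> S" for f
    using Comp_Ident(2)[OF category_CGWH inS[OF that]] .
  ultimately have "Comp (CGWH small) e r = Ident (CGWH small) X"
    using amalgam[of X "\<lambda>f. f"] er Ident_in_hom[OF category_CGWH X] by blast
  then have "fn (Comp (CGWH small) e r) x = x" if "x \<in> topspace X" for x
    using that by simp
  moreover have "fn (Comp (CGWH small) e r) x = fn r x" if "x \<in> topspace X" for x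
    using that r CGWH_hom_funspace[OF r that] by (simp add: compose_def e_def CGWH_hom_iff)
  ultimately have rid: "fn r x = x" if "x \<in> topspace X" for x
    using that by simp
  have rc: "continuous_map X ?T (fn r)"
    using r by (simp add: CGWH_hom_iff)
  have sub: "topspace X \<subseteq> sieve_image S"
    using CGWH_hom_funspace[OF r] rid by fastforce
  have "closedin X Z"
    if Z: "Z \<subseteq> topspace X"
      and closed: "\<forall>f\<in>S. closedin (source f) {a \<in> topspace (source f). fn f a \<in> Z}" for Z
  proof -
    have "closedin ?T Z"
      using closed Z sub by (auto simp: closedin_final_topology)
    then have "closedin X {x \<in> topspace X. fn r x \<in> Z}"
      by (rule closedin_continuous_map_preimage[OF rc])
    moreover have "{x \<in> topspace X. fn r x \<in> Z} = Z"
      using Z rid by auto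
    ultimately show ?thesis
      by simp
  qed
  then show ?thesis
    using sub unfolding jointly_quotient_def sieve_image_def by blast
qed

lemma effective_iff_jointly_quotient:
  assumes "X \<in> Obj (CGWH small)"
  shows "effective_sieve (CGWH small) X S \<longleftrightarrow> sieve (CGWH small) X S \<and> jointly_quotient X S"
  using assms jointly_quotient_imp_effective effective_imp_jointly_quotient effective_sieve_def
  by metis

lemma colim_sieve_iff_jointly_quotient:
  assumes "X \<in> Obj (CGWH small)"
  shows "colim_sieve (CGWH small) X S \<longleftrightarrow> sieve (CGWH small) X S \<and> jointly_quotient X S"
  using assms by (simp add: colim_sieve_iff_effective[OF category_CGWH] effective_iff_jointly_quotient)

section \<open>Pullbacks in \<open>CGWH\<close>\<close>

text \<open>The pullback is the fibre product of sets with the compactly generated refinement of the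
  subspace topology, moved to a copy inside \<open>'u\<close>.\<close>

lemma has_pullbacks_CGWH: "has_pullbacks (CGWH small)"
  unfolding has_pullbacks_def
proof (intro ballI impI)
  fix f g assume "f \<in> Arr (CGWH small)" "g \<in> Arr (CGWH small)"
    and cod: "Cod (CGWH small) f = Cod (CGWH small) g"
  define A where "A = source f"
  define B where "B = source g"
  define X where "X = target f"
  have f: "f \<in> hom (CGWH small) A X" and g: "g \<in> hom (CGWH small) B X"
    using \<open>f \<in> _\<close> \<open>g \<in> _\<close> cod by (auto simp: hom_def A_def B_def X_def)
  have A: "A \<in> Obj (CGWH small)" and B: "B \<in> Obj (CGWH small)"
    using f g by (simp_all add: CGWH_hom_iff)
  define E where "E = {(a, b). fn f a = fn g b}"
  define T where "T = subtopology (prod_topology A B) E"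
  have topT: "topspace T = {(a, b). a \<in> topspace A \<and> b \<in> topspace B \<and> fn f a = fn g b}"
    by (auto simp: T_def E_def)
  obtain M j where M: "small (topspace M)" and j: "homeomorphic_map M T j"
    using small_copy_of_product_subspace[of "topspace A" "topspace B" T] A B
    by (auto simp: topT CGWH_Obj_iff)
  then obtain i where ji: "homeomorphic_maps M T j i"
    using homeomorphic_map_maps by blast
  then have jT: "continuous_map M T j" and iT: "continuous_map T M i"
    and ij: "\<And>z. z \<in> topspace M \<Longrightarrow> i (j z) = z" and ji': "\<And>t. t \<in> topspace T \<Longrightarrow> j (i t) = t"
    by (auto simp: homeomorphic_maps_def)
  have jc: "continuous_map M (prod_topology A B) j"
    using jT unfolding T_def by (rule continuous_map_into_fulltopology)
  define P where "P = k_ification small M"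
  have "weakly_hausdorff small M"
    using weakly_hausdorff_injective[OF weakly_hausdorff_prod jc] A B ij
    by (auto simp: CGWH_Obj_iff intro: inj_on_inverseI)
  then have "weakly_hausdorff small P"
    unfolding P_def using weakly_hausdorff_injective[OF _ continuous_map_k_ification_id] by simp
  then have P: "P \<in> Obj (CGWH small)"
    using M by (simp add: CGWH_Obj_iff P_def compactly_generated_k_ification)
  have topP: "topspace P = topspace M"
    by (simp add: P_def)
  have jP: "continuous_map P (prod_topology A B) j"
    using continuous_map_compose[OF continuous_map_k_ification_id jc] by (simp add: P_def o_def)
  define p where "p = cmap_on P A (\<lambda>z. fst (j z))"
  define q where "q = cmap_on P B (\<lambda>z. snd (j z))"
  have p: "p \<in> hom (CGWH small) P A" and q: "q \<in> hom (CGWH small) P B"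
    unfolding p_def q_def using cmap_on_in_hom[OF P A] cmap_on_in_hom[OF P B] jP
    by (simp_all add: continuous_map_pairwise o_def)
  have jz: "fst (j z) \<in> topspace A" "snd (j z) \<in> topspace B" "fn f (fst (j z)) = fn g (snd (j z))"
    if "z \<in> topspace P" for z
  proof -
    have "j z \<in> topspace T"
      using continuous_map_funspace[OF jT] that topP by auto
    then show "fst (j z) \<in> topspace A" "snd (j z) \<in> topspace B" "fn f (fst (j z)) = fn g (snd (j z))"
      by (auto simp: topT)
  qed
  have src: "source f = A" "source g = B" "source p = P" "source q = P"
    using f g p q by (simp_all add: CGWH_hom_iff)
  have "is_pullback (CGWH small) f g p q"
    unfolding is_pullback_def CGWH_simps src
  proof (intro conjI allI ballI impI p q)
    show "Comp (CGWH small) f p = Comp (CGWH small) g q"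
    proof (rule CGWH_hom_eqI)
      show "Comp (CGWH small) f p \<in> hom (CGWH small) P X" "Comp (CGWH small) g q \<in> hom (CGWH small) P X"
        using Comp_in_hom[OF category_CGWH p f] Comp_in_hom[OF category_CGWH q g] .
    qed (simp add: src compose_def p_def q_def jz)
  next
    fix W a b
    assume a: "a \<in> hom (CGWH small) W A" and b: "b \<in> hom (CGWH small) W B"
      and eq: "Comp (CGWH small) f a = Comp (CGWH small) g b"
    have W: "W \<in> Obj (CGWH small)" "source a = W" "source b = W"
      and ab: "continuous_map W A (fn a)" "continuous_map W B (fn b)"
      using a b by (simp_all add: CGWH_hom_iff)
    define u where "u w = i (fn a w, fn b w)" for w
    have abT: "(fn a w, fn b w) \<in> topspace T" if "w \<in> topspace W" for w
      using arg_cong[OF eq, of "\<lambda>h. fn h w"] that CGWH_hom_funspace[OF a that]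
        CGWH_hom_funspace[OF b that] W by (simp add: compose_def topT)
    have "continuous_map W T (\<lambda>w. (fn a w, fn b w))"
      using ab abT unfolding T_def by (auto simp: continuous_map_in_subtopology continuous_map_paired)
    then have "continuous_map W M u"
      using continuous_map_compose[OF _ iT] by (fastforce simp: u_def[abs_def] o_def)
    then have "continuous_map W P u"
      unfolding P_def using W by (intro continuous_map_into_k_ification) (auto simp: CGWH_Obj_iff)
    then have uh: "cmap_on W P u \<in> hom (CGWH small) W P"
      using cmap_on_in_hom[OF W(1) P] by blast
    have up: "u w \<in> topspace P" if "w \<in> topspace W" for w
      using CGWH_hom_funspace[OF uh that] that by simp
    have ju: "j (u w) = (fn a w, fn b w)" if "w \<in> topspace W" for w
      unfolding u_def using ji'[OF abT[OF that]] .
    show "\<exists>!u. u \<in> hom (CGWH small) W P \<and> Comp (CGWH small) p u = a \<and> Comp (CGWH small) q u = b"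
    proof (intro ex1I[of _ "cmap_on W P u"] conjI uh)
      show "Comp (CGWH small) p (cmap_on W P u) = a"
        by (rule CGWH_hom_eqI[OF Comp_in_hom[OF category_CGWH uh p] a])
          (simp add: compose_def p_def up ju)
      show "Comp (CGWH small) q (cmap_on W P u) = b"
        by (rule CGWH_hom_eqI[OF Comp_in_hom[OF category_CGWH uh q] b])
          (simp add: compose_def q_def up ju)
    next
      fix u' assume u': "u' \<in> hom (CGWH small) W P \<and> Comp (CGWH small) p u' = a \<and>
        Comp (CGWH small) q u' = b"
      then have h: "u' \<in> hom (CGWH small) W P" and s: "source u' = W"
        by (auto simp: CGWH_hom_iff)
      show "u' = cmap_on W P u"
      proof (rule CGWH_hom_eqI[OF h uh])
        fix w assume w: "w \<in> topspace W"
        have z: "fn u' w \<in> topspace P"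
          using CGWH_hom_funspace[OF h w] .
        have "fn (Comp (CGWH small) p u') w = fn a w" "fn (Comp (CGWH small) q u') w = fn b w"
          using u' by auto
        then have "fst (j (fn u' w)) = fn a w" "snd (j (fn u' w)) = fn b w"
          using w s z by (auto simp: compose_def p_def q_def)
        then have "j (fn u' w) = j (u w)"
          unfolding ju[OF w] by (simp add: prod_eq_iff)
        then have "fn u' w = u w"
          using ij z up[OF w] topP by metis
        then show "fn u' w = fn (cmap_on W P u) w"
          using w by simp
      qed
    qed
  qed
  then show "\<exists>p q. is_pullback (CGWH small) f g p q"
    by blast
qed

end


section \<open>The topology generated by quotient families\<close>

lemma sizes_of_size_regime: "size_regime small indexing \<Longrightarrow> sizes small"
  unfolding size_regime_def by unfold_locales blast+

lemma size_regime_indexing: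
  assumes "size_regime small indexing"
  shows indexing_singleton: "indexing {a}"
    and indexing_Pow: "small A \<Longrightarrow> \<exists>I. indexing I \<and> Pow A \<lesssim> I"
    and indexing_Sigma: "indexing I \<Longrightarrow> (\<And>i. i \<in> I \<Longrightarrow> indexing (J i)) \<Longrightarrow>
      L \<lesssim> Sigma I J \<Longrightarrow> indexing L"
proof -
  have 1: "\<forall>a. indexing {a}" and 2: "\<forall>A. small A \<longrightarrow> (\<exists>I. indexing I \<and> Pow A \<lesssim> I)"
    and 3: "\<forall>I J L. indexing I \<and> (\<forall>i\<in>I. indexing (J i)) \<and> L \<lesssim> Sigma I J \<longrightarrow> indexing L"
    using assms unfolding size_regime_def by - (elim conjE, assumption)+
  show "indexing {a}"
    using 1 by blast
  show "\<exists>I. indexing I \<and> Pow A \<lesssim> I" if "small A"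
    using 2 that by blast
  show "indexing L" if "indexing I" "\<And>i. i \<in> I \<Longrightarrow> indexing (J i)" "L \<lesssim> Sigma I J"
    using 3 that by blast
qed

lemma quotient_families_iff:
  "(I, f) \<in> quotient_families small indexing X \<longleftrightarrow>
     indexing I \<and> (\<forall>i\<in>I. f i \<in> arrows_to (CGWH small) X) \<and> jointly_quotient X (f ` I)"
  unfolding quotient_families_def using coproduct_quotient_iff_jointly_quotient[of I f small X]
  by auto

lemma in_generated_sieve:
  assumes "i \<in> I" "f i \<in> arrows_to (CGWH small) X"
  shows "f i \<in> generated_sieve (CGWH small) X I f"
proof -
  have fi: "f i \<in> hom (CGWH small) (source (f i)) X"
    using assms(2) by (simp add: CGWH_arrows_to_iff)
  then have "Ident (CGWH small) (source (f i)) \<in> hom (CGWH small) (source (f i)) (source (f i))"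
    by (intro Ident_in_hom[OF category_CGWH]) (simp add: CGWH_hom_iff)
  moreover have "f i = Comp (CGWH small) (f i) (Ident (CGWH small) (source (f i)))"
    using Comp_Ident(1)[OF category_CGWH fi] by (rule sym)
  ultimately show ?thesis
    unfolding generated_sieve_def CGWH_simps(1) mem_Collect_eq using assms
    by (intro conjI bexI[of _ i] bexI[of _ "Ident (CGWH small) (source (f i))"])
qed

lemma jointly_quotient_generated_sieve_iff:
  assumes "\<And>i. i \<in> I \<Longrightarrow> f i \<in> arrows_to (CGWH small) X"
  shows "jointly_quotient X (generated_sieve (CGWH small) X I f) \<longleftrightarrow> jointly_quotient X (f ` I)"
proof
  assume "jointly_quotient X (f ` I)"
  then show "jointly_quotient X (generated_sieve (CGWH small) X I f)"
    by (rule jointly_quotient_mono) (auto intro!: in_generated_sieve assms)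
next
  assume "jointly_quotient X (generated_sieve (CGWH small) X I f)"
  then show "jointly_quotient X (f ` I)"
  proof (rule jointly_quotient_refine)
    fix h assume "h \<in> generated_sieve (CGWH small) X I f"
    then obtain i g where "i \<in> I" and g: "g \<in> hom (CGWH small) (source h) (source (f i))"
      and h: "h = Comp (CGWH small) (f i) g"
      by (auto simp: generated_sieve_def)
    moreover have "fn h a = fn (f i) (fn g a)" if "a \<in> topspace (source h)" for a
      using that by (simp add: h compose_def)
    ultimately show "\<exists>g\<in>f ` I. \<exists>k. continuous_map (source h) (source g) k \<and>
        (\<forall>a\<in>topspace (source h). fn h a = fn g (k a))"
      by (intro bexI[of _ "f i"] exI[of _ "fn g"]) (auto simp: CGWH_hom_iff)
  qed
qed

text \<open>A sieve is jointly quotient because of choices that can be made subset by subset of \<open>X\<close>, so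
  as many of its members as there are subsets of \<open>X\<close> suffice.\<close>

lemma indexed_quotient_subfamily:
  assumes reg: "size_regime small indexing" and X: "X \<in> Obj (CGWH small)"
    and quot: "jointly_quotient X S"
  obtains I f where "indexing I" "f ` I \<subseteq> S" "jointly_quotient X (f ` I)"
proof -
  \<comment> \<open>Non-closed sets ask for a member that sees this.  As singletons are closed, they are free to
    ask for a member that hits their point, so that one index set serves both purposes.\<close>
  define detects where "detects Z h \<longleftrightarrow>
      (if closedin X Z then \<exists>x. Z = {x} \<and> x \<in> fn h ` topspace (source h)
       else \<not> closedin (source h) {a \<in> topspace (source h). fn h a \<in> Z})" for Z h
  define D where "D = {Z. Z \<subseteq> topspace X \<and> (\<exists>h\<in>S. detects Z h)}"
  obtain I0 where I0: "indexing I0" and "Pow (topspace X) \<lesssim> I0"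
    using indexing_Pow[OF reg, of "topspace X"] X by (auto simp: CGWH_Obj_iff)
  then obtain e where inj: "inj_on e (Pow (topspace X))" and e: "e ` Pow (topspace X) \<subseteq> I0"
    by (auto simp: lepoll_def)
  have DP: "D \<subseteq> Pow (topspace X)"
    by (auto simp: D_def)
  have "e ` D \<lesssim> Sigma I0 (\<lambda>i. {i})"
    unfolding lepoll_def using e DP by (intro exI[of _ "\<lambda>i. (i, i)"]) (auto simp: inj_on_def)
  then have "indexing (e ` D)"
    by (rule indexing_Sigma[OF reg I0 indexing_singleton[OF reg]])
  moreover have "\<forall>Z\<in>D. \<exists>h. h \<in> S \<and> detects Z h"
    by (auto simp: D_def)
  then obtain h where h: "\<And>Z. Z \<in> D \<Longrightarrow> h Z \<in> S \<and> detects Z (h Z)"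
    by metis
  define f where "f i = h (inv_into D e i)" for i
  have "f (e Z) = h Z" if "Z \<in> D" for Z
    using that inv_into_f_f[OF inj_on_subset[OF inj DP]] by (simp add: f_def)
  then have image: "f ` e ` D = h ` D"
    by (force simp: image_image)
  moreover have "h ` D \<subseteq> S"
    using h by blast
  moreover have "jointly_quotient X (h ` D)"
    unfolding jointly_quotient_def
  proof (intro conjI ballI allI impI)
    fix x assume x: "x \<in> topspace X"
    then have closed: "closedin X {x}"
      using X CGWH_singleton_closed by (auto simp: CGWH_Obj_iff)
    obtain g where "g \<in> S" "x \<in> fn g ` topspace (source g)"
      using quot x by (force simp: jointly_quotient_def)
    then have xD: "{x} \<in> D"
      using x closed by (auto simp: D_def detects_def)
    then obtain a where "a \<in> topspace (source (h {x}))" "fn (h {x}) a = x"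
      using h[OF xD] closed by (auto simp: detects_def)
    then show "\<exists>g\<in>h ` D. \<exists>a\<in>topspace (source g). fn g a = x"
      using xD by (intro bexI[of _ "h {x}"] bexI[of _ a]) auto
  next
    fix Z assume Z: "Z \<subseteq> topspace X"
      and closed: "\<forall>g\<in>h ` D. closedin (source g) {a \<in> topspace (source g). fn g a \<in> Z}"
    show "closedin X Z"
    proof (rule ccontr)
      assume not_closed: "\<not> closedin X Z"
      then obtain g where "g \<in> S" "\<not> closedin (source g) {a \<in> topspace (source g). fn g a \<in> Z}"
        using quot Z unfolding jointly_quotient_def by blast
      then have ZD: "Z \<in> D"
        using Z not_closed by (auto simp: D_def detects_def)
      then show False
        using h[OF ZD] closed not_closed by (auto simp: detects_def)
    qed
  qed
  ultimately show ?thesis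
    using that[of "e ` D" f] by simp
qed

lemma generated_topology_quotient_families:
  assumes "size_regime small indexing" "X \<in> Obj (CGWH small)"
  shows "generated_topology (CGWH small) (quotient_families small indexing) X =
    {S. sieve (CGWH small) X S \<and> jointly_quotient X S}"
proof (intro set_eqI iffI; clarify)
  fix S assume "S \<in> generated_topology (CGWH small) (quotient_families small indexing) X"
  then show "sieve (CGWH small) X S \<and> jointly_quotient X S"
    by (auto simp: generated_topology_def quotient_families_iff intro: jointly_quotient_mono)
next
  fix S assume S: "sieve (CGWH small) X S" and "jointly_quotient X S"
  then obtain I f where "indexing I" "f ` I \<subseteq> S" "jointly_quotient X (f ` I)"
    using indexed_quotient_subfamily[OF assms] by metis
  moreover from this have "(I, f) \<in> quotient_families small indexing X"
    using S by (auto simp: quotient_families_iff sieve_def)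
  ultimately show "S \<in> generated_topology (CGWH small) (quotient_families small indexing) X"
    unfolding generated_topology_def using S by blast
qed

lemma is_pullbackD:
  assumes "is_pullback C f g p q"
  shows "q \<in> hom C (Dom C p) (Dom C g)"
    and "a \<in> hom C W (Dom C f) \<Longrightarrow> b \<in> hom C W (Dom C g) \<Longrightarrow> Comp C f a = Comp C g b \<Longrightarrow>
      \<exists>u. u \<in> hom C W (Dom C p) \<and> Comp C q u = b"
proof -
  show "q \<in> hom C (Dom C p) (Dom C g)"
    using assms unfolding is_pullback_def by (elim conjE)
  have "\<forall>W. \<forall>a\<in>hom C W (Dom C f). \<forall>b\<in>hom C W (Dom C g). Comp C f a = Comp C g b \<longrightarrow>
      (\<exists>!u. u \<in> hom C W (Dom C p) \<and> Comp C p u = a \<and> Comp C q u = b)"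
    using assms unfolding is_pullback_def by (elim conjE)
  then show "\<exists>u. u \<in> hom C W (Dom C p) \<and> Comp C q u = b"
    if "a \<in> hom C W (Dom C f)" "b \<in> hom C W (Dom C g)" "Comp C f a = Comp C g b"
    using that by fast
qed

text \<open>An arrow \<open>h\<close> lies in the pullback of the generated sieve just when \<open>g \<circ> h\<close> factors through some
  \<open>f i\<close>, which makes \<open>h\<close> factor through \<open>q i\<close>.  So stability of families reduces to that of
  sieves.\<close>

lemma jointly_quotient_pulled_back_family:
  assumes "sizes small" and f: "\<And>i. i \<in> I \<Longrightarrow> f i \<in> arrows_to (CGWH small) X"
    and quot: "jointly_quotient X (f ` I)" and g: "g \<in> hom (CGWH small) Y X"
    and pb: "\<And>i. i \<in> I \<Longrightarrow> is_pullback (CGWH small) (f i) g (p i) (q i)"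
  shows "jointly_quotient Y (q ` I)"
proof -
  have "sieve (CGWH small) X (generated_sieve (CGWH small) X I f)"
    by (rule sieve_generated_sieve[OF category_CGWH]) (rule f)
  moreover have "jointly_quotient X (generated_sieve (CGWH small) X I f)"
    using jointly_quotient_generated_sieve_iff[of I f small X] f quot by simp
  ultimately have "jointly_quotient Y
      (sieve_pullback (CGWH small) g (generated_sieve (CGWH small) X I f))"
    using sizes.jointly_quotient_sieve_pullback[OF assms(1)] g by blast
  then show ?thesis
  proof (rule jointly_quotient_refine)
    fix h assume "h \<in> sieve_pullback (CGWH small) g (generated_sieve (CGWH small) X I f)"
    then obtain i k where h: "h \<in> hom (CGWH small) (source h) (source g)" and i: "i \<in> I"
      and k: "k \<in> hom (CGWH small) (source h) (source (f i))"
      and eq: "Comp (CGWH small) (f i) k = Comp (CGWH small) g h"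
      by (auto simp: sieve_pullback_def generated_sieve_def CGWH_arrows_to_iff)
    obtain u where u: "u \<in> hom (CGWH small) (source h) (source (p i))"
      and qu: "Comp (CGWH small) (q i) u = h"
      using is_pullbackD(2)[OF pb[OF i], of k "source h" h] h k eq by auto
    have "source (q i) = source (p i)"
      using is_pullbackD(1)[OF pb[OF i]] by (simp add: CGWH_hom_iff)
    moreover have "fn h a = fn (q i) (fn u a)" if "a \<in> topspace (source h)" for a
      using that u arg_cong[OF qu, of "\<lambda>h. fn h a"] by (simp add: compose_def CGWH_hom_iff)
    ultimately show "\<exists>g\<in>q ` I. \<exists>k. continuous_map (source h) (source g) k \<and>
        (\<forall>a\<in>topspace (source h). fn h a = fn g (k a))"
      using i u by (intro bexI[of _ "q i"] exI[of _ "fn u"]) (auto simp: CGWH_hom_iff)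
  qed
qed

lemma grothendieck_basis_quotient_families:
  assumes reg: "size_regime small indexing"
  shows "grothendieck_basis (CGWH small) (quotient_families small indexing)"
proof -
  have sz: "sizes small"
    using sizes_of_size_regime[OF reg] .
  have iso: "({i}, f) \<in> quotient_families small indexing X"
    if f: "f i \<in> arrows_to (CGWH small) X" "iso (CGWH small) (f i)" for X i f
  proof -
    have "jointly_quotient X (f ` {i})"
      using jointly_quotient_iso[OF f(2)] f(1) by (simp add: CGWH_arrows_to_iff CGWH_hom_iff)
    then show ?thesis
      using f(1) indexing_singleton[OF reg] by (simp add: quotient_families_iff)
  qed
  have pullback: "(I, q) \<in> quotient_families small indexing (source g)"
    if K: "(I, f) \<in> quotient_families small indexing X" and g: "g \<in> arrows_to (CGWH small) X"
      and pb: "\<forall>i\<in>I. is_pullback (CGWH small) (f i) g (p i) (q i)" for X I f g p q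
  proof -
    have "q i \<in> arrows_to (CGWH small) (source g)" if "i \<in> I" for i
      using is_pullbackD(1)[OF bspec[OF pb that]] by (simp add: CGWH_arrows_to_iff CGWH_hom_iff)
    moreover have "jointly_quotient (source g) (q ` I)"
      by (rule jointly_quotient_pulled_back_family[OF sz, where f = f and g = g and p = p and X = X])
        (use K g pb in \<open>auto simp: quotient_families_iff CGWH_arrows_to_iff\<close>)
    ultimately show ?thesis
      using K by (simp add: quotient_families_iff)
  qed
  have trans: "(L, \<lambda>l. Comp (CGWH small) (f (fst (e l))) (g (fst (e l)) (snd (e l))))
      \<in> quotient_families small indexing X"
    if K: "(I, f) \<in> quotient_families small indexing X"
      and J: "\<forall>i\<in>I. (J i, g i) \<in> quotient_families small indexing (source (f i))"
      and e: "bij_betw e L (Sigma I J)" for X I f J g L and e :: "'a \<Rightarrow> 'a \<times> 'a"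
  proof -
    define c where "c l = Comp (CGWH small) (f (fst (e l))) (g (fst (e l)) (snd (e l)))" for l
    have "L \<lesssim> Sigma I J"
      unfolding lepoll_def using e by (auto simp: bij_betw_def)
    then have "indexing L"
      by (rule indexing_Sigma[OF reg, rotated 2]) (use K J in \<open>auto simp: quotient_families_iff\<close>)
    moreover have arrow: "Comp (CGWH small) (f i) (g i j) \<in> arrows_to (CGWH small) X"
      if "i \<in> I" "j \<in> J i" for i j
      using Comp_in_hom[OF category_CGWH, of "g i j" small "source (g i j)" "source (f i)" "f i" X]
        that K J by (auto simp: quotient_families_iff CGWH_arrows_to_iff)
    have "c l \<in> arrows_to (CGWH small) X" if "l \<in> L" for l
      using arrow bij_betwE[OF e] that unfolding c_def by fastforce
    moreover have "jointly_quotient X (c ` L)"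
    proof (rule jointly_quotient_local)
      show "jointly_quotient X (f ` I)"
        using K by (simp add: quotient_families_iff)
    next
      fix h assume "h \<in> f ` I"
      then obtain i where i: "i \<in> I" and h: "h = f i"
        by blast
      have "jointly_quotient (source h) (g i ` J i)"
        using J i h by (simp add: quotient_families_iff)
      moreover have "g i ` J i \<subseteq> sieve_pullback (CGWH small) h (c ` L)"
      proof (intro image_subsetI)
        fix j assume j: "j \<in> J i"
        then obtain l where l: "l \<in> L" "e l = (i, j)"
          using e i unfolding bij_betw_def by (metis SigmaI imageE)
        then have "Comp (CGWH small) h (g i j) = c l"
          by (simp add: c_def h)
        then show "g i j \<in> sieve_pullback (CGWH small) h (c ` L)"
          using J i j h l(1) by (auto simp: sieve_pullback_def quotient_families_iff)
      qed
      ultimately show "jointly_quotient (source h) (sieve_pullback (CGWH small) h (c ` L))"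
        by (rule jointly_quotient_mono)
    qed
    ultimately show ?thesis
      by (simp add: quotient_families_iff c_def[abs_def])
  qed
  show ?thesis
    unfolding grothendieck_basis_def CGWH_simps
  proof (intro conjI)
    show "has_pullbacks (CGWH small)"
      using sizes.has_pullbacks_CGWH[OF sz] .
    show "\<forall>X\<in>Obj (CGWH small). \<forall>(I, f)\<in>quotient_families small indexing X.
        \<forall>i\<in>I. f i \<in> arrows_to (CGWH small) X"
      by (auto simp: quotient_families_iff)
    show "\<forall>X\<in>Obj (CGWH small). \<forall>i f. f i \<in> arrows_to (CGWH small) X \<and> iso (CGWH small) (f i) \<longrightarrow>
        ({i}, f) \<in> quotient_families small indexing X"
      using iso by blast
    show "\<forall>X\<in>Obj (CGWH small). \<forall>(I, f)\<in>quotient_families small indexing X.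
        \<forall>g\<in>arrows_to (CGWH small) X. \<forall>p q. (\<forall>i\<in>I. is_pullback (CGWH small) (f i) g (p i) (q i)) \<longrightarrow>
          (I, q) \<in> quotient_families small indexing (source g)"
      by clarify (rule pullback)
    show "\<forall>X\<in>Obj (CGWH small). \<forall>(I, f)\<in>quotient_families small indexing X.
        \<forall>J g. (\<forall>i\<in>I. (J i, g i) \<in> quotient_families small indexing (source (f i))) \<longrightarrow>
          (\<forall>L e. bij_betw e L (Sigma I J) \<longrightarrow>
            (L, \<lambda>l. Comp (CGWH small) (f (fst (e l))) (g (fst (e l)) (snd (e l))))
              \<in> quotient_families small indexing X)"
      by clarify (rule trans)
  qed
qed

lemma generated_topology_is_topology:
  assumes reg: "size_regime small indexing"
  shows "grothendieck_topology (CGWH small)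
    (generated_topology (CGWH small) (quotient_families small indexing))"
proof -
  interpret sizes small
    using sizes_of_size_regime[OF reg] .
  note gen = generated_topology_quotient_families[OF reg]
  have max: "jointly_quotient X (arrows_to (CGWH small) X)" if X: "X \<in> Obj (CGWH small)" for X
  proof -
    have "jointly_quotient X {Ident (CGWH small) X}"
      using jointly_quotient_iso[OF iso_Ident[OF category_CGWH X]] by simp
    then show ?thesis
      by (rule jointly_quotient_mono)
        (use Ident_in_hom[OF category_CGWH X] in \<open>simp add: CGWH_arrows_to_iff\<close>)
  qed
  have src: "source h \<in> Obj (CGWH small)" "h \<in> hom (CGWH small) (source h) X"
    if "h \<in> arrows_to (CGWH small) X" for h X
    using that by (auto simp: CGWH_arrows_to_iff CGWH_hom_iff)
  have pullback: "sieve (CGWH small) (source h) (sieve_pullback (CGWH small) h S)"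
    if "sieve (CGWH small) X S" "h \<in> arrows_to (CGWH small) X" for X S h
    using sieve_sieve_pullback[OF category_CGWH that] by simp
  have local: "jointly_quotient X R"
    if S: "sieve (CGWH small) X S" "jointly_quotient X S"
      and R: "\<forall>h\<in>S. sieve_pullback (CGWH small) h R \<in>
        generated_topology (CGWH small) (quotient_families small indexing) (source h)" for X S R
  proof (rule jointly_quotient_local[OF S(2)])
    fix h assume h: "h \<in> S"
    then have "source h \<in> Obj (CGWH small)"
      using S(1) src(1) by (auto simp: sieve_def)
    then show "jointly_quotient (source h) (sieve_pullback (CGWH small) h R)"
      using R h gen by blast
  qed
  let ?J = "generated_topology (CGWH small) (quotient_families small indexing)"
  show ?thesis
    unfolding grothendieck_topology_def CGWH_simps
  proof (intro conjI ballI allI impI)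
    show "sieve (CGWH small) X S" if "X \<in> Obj (CGWH small)" "S \<in> ?J X" for X S
      using that gen by simp
    show "arrows_to (CGWH small) X \<in> ?J X" if "X \<in> Obj (CGWH small)" for X
      using that gen max sieve_arrows_to[OF category_CGWH] by simp
    show "sieve_pullback (CGWH small) h S \<in> ?J (source h)"
      if "X \<in> Obj (CGWH small)" "S \<in> ?J X" "h \<in> arrows_to (CGWH small) X" for X S h
    proof -
      have "sieve (CGWH small) X S" "jointly_quotient X S"
        using that gen by auto
      then show ?thesis
        using that(3) src[OF that(3)] pullback gen jointly_quotient_sieve_pullback by simp
    qed
    show "R \<in> ?J X"
      if "X \<in> Obj (CGWH small)" "S \<in> ?J X"
        "sieve (CGWH small) X R \<and> (\<forall>h\<in>S. sieve_pullback (CGWH small) h R \<in> ?J (source h))"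
      for X S R
      using that gen local[of X S R] by simp
  qed
qed

lemma is_canonical_topology_unique:
  assumes "is_canonical_topology C J" "is_canonical_topology C J'" "X \<in> Obj C"
  shows "J X = J' X"
  using assms unfolding is_canonical_topology_def by blast

text \<open>By definition a topology is subcanonical if and only if it consists of effective sieves, and
  the generated topology consists of all of them.\<close>

lemma generated_topology_is_canonical:
  assumes reg: "size_regime small indexing"
  shows "is_canonical_topology (CGWH small)
    (generated_topology (CGWH small) (quotient_families small indexing))"
proof -
  interpret sizes small
    using sizes_of_size_regime[OF reg] .
  have gen: "generated_topology (CGWH small) (quotient_families small indexing) X =
      {S. effective_sieve (CGWH small) X S}" if "X \<in> Obj (CGWH small)" for X
    using generated_topology_quotient_families[OF reg that] effective_iff_jointly_quotient[OF that]
    by simp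
  have "subcanonical (CGWH small) (generated_topology (CGWH small) (quotient_families small indexing))"
    by (subst subcanonical_iff_effective) (auto simp: gen effective_sieve_def)
  moreover have "J X \<subseteq> generated_topology (CGWH small) (quotient_families small indexing) X"
    if J: "grothendieck_topology (CGWH small) J" "subcanonical (CGWH small) J"
      and X: "X \<in> Obj (CGWH small)" for J X
  proof -
    have "sieve (CGWH small) Y S" if "Y \<in> Obj (CGWH small)" "S \<in> J Y" for Y S
      using J(1) that unfolding grothendieck_topology_def by blast
    then show ?thesis
      using J(2) X subcanonical_iff_effective[of "CGWH small" J] gen by auto
  qed
  ultimately show ?thesis
    unfolding is_canonical_topology_def using generated_topology_is_topology[OF reg] by blast
qed

lemma colim_sieve_universal:
  assumes "sizes small" and X: "X \<in> Obj (CGWH small)" and S: "colim_sieve (CGWH small) X S"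
  shows "universal_colim_sieve (CGWH small) X S"
proof -
  interpret sizes small
    by fact
  have S': "sieve (CGWH small) X S" "jointly_quotient X S"
    using S colim_sieve_iff_jointly_quotient[OF X] by auto
  have "colim_sieve (CGWH small) (source a) (sieve_pullback (CGWH small) a S)"
    if a: "a \<in> arrows_to (CGWH small) X" for a
  proof -
    have ah: "a \<in> hom (CGWH small) (source a) X" and "source a \<in> Obj (CGWH small)"
      using a by (auto simp: CGWH_arrows_to_iff CGWH_hom_iff)
    then show ?thesis
      using colim_sieve_iff_jointly_quotient sieve_sieve_pullback[OF category_CGWH S'(1) a]
        jointly_quotient_sieve_pullback[OF S' ah] by simp
  qed
  then show ?thesis
    using S' by (simp add: universal_colim_sieve_def)
qed

theorem proposition4p7:
  fixes small indexing :: "'u set \<Rightarrow> bool"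
  assumes "size_regime small indexing"
  shows "grothendieck_basis (CGWH small) (quotient_families small indexing)
    \<and> is_canonical_topology (CGWH small)
        (generated_topology (CGWH small) (quotient_families small indexing))
    \<and> (\<forall>J. is_canonical_topology (CGWH small) J \<longrightarrow>
        (\<forall>X\<in>Obj (CGWH small). \<forall>(I :: 'u set) f.
           indexing I \<and> (\<forall>i\<in>I. f i \<in> arrows_to (CGWH small) X) \<longrightarrow>
           (generated_sieve (CGWH small) X I f \<in> J X \<longleftrightarrow> coproduct_quotient X I f)))
    \<and> (\<forall>X\<in>Obj (CGWH small). \<forall>S.
        colim_sieve (CGWH small) X S \<longrightarrow> universal_colim_sieve (CGWH small) X S)"
proof (intro conjI allI ballI impI)
  show "grothendieck_basis (CGWH small) (quotient_families small indexing)"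
    using grothendieck_basis_quotient_families[OF assms] .
  show canonical: "is_canonical_topology (CGWH small)
      (generated_topology (CGWH small) (quotient_families small indexing))"
    using generated_topology_is_canonical[OF assms] .
  show "universal_colim_sieve (CGWH small) X S"
    if "X \<in> Obj (CGWH small)" "colim_sieve (CGWH small) X S" for X S
    using colim_sieve_universal[OF sizes_of_size_regime[OF assms] that] .
  fix J X and I :: "'u set" and f
  assume J: "is_canonical_topology (CGWH small) J" and X: "X \<in> Obj (CGWH small)"
    and I: "indexing I \<and> (\<forall>i\<in>I. f i \<in> arrows_to (CGWH small) X)"
  have "generated_sieve (CGWH small) X I f \<in> J X \<longleftrightarrow>
      jointly_quotient X (generated_sieve (CGWH small) X I f)"
    unfolding is_canonical_topology_unique[OF J canonical X]
      generated_topology_quotient_families[OF assms X]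
    using I sieve_generated_sieve[OF category_CGWH, of I f small X] by simp
  also have "\<dots> \<longleftrightarrow> jointly_quotient X (f ` I)"
    using I by (intro jointly_quotient_generated_sieve_iff) simp
  also have "\<dots> \<longleftrightarrow> coproduct_quotient X I f"
    using I coproduct_quotient_iff_jointly_quotient[of I f small X] by simp
  finally show "generated_sieve (CGWH small) X I f \<in> J X \<longleftrightarrow> coproduct_quotient X I f" .
qed

end
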